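(* Let $M,N$ be positive integers, $\{x\}=\{x_1,\dots,x_N\}$, $\{y\}=\{y_1,\dots,y_N\}$. Then $$\langle 0|\mathbf{C}(x_N)\cdots\mathbf{C}(x_1)\mathbf{B}(y_1)\cdots \mathbf{B}(y_N)|0\rangle =\sum_{\mu\subseteq[N,M]}s_\mu\{x\}s_\mu\{y\},$$ where $\mu$ runs over all partitions with at most $N$ parts and largest part at most $M$. In particular, when $M\to\infty$, $$\lim_{M\to\infty}\langle 0|\mathbf{C}(x_N)\cdots\mathbf{C}(x_1)\mathbf{B}(y_1)\cdots \mathbf{B}(y_N)|0\rangle =\prod_{i, j=1}^N\frac1{1-x_iy_j}=\sum_{l(\mu)\leq N}s_\mu\{x\}s_\mu\{y\}$$ as formal power series.
   Context: $b(i),c(i)$ ($i\in\mathbb Z$) satisfy $\{b(i),c(j)\}=\delta_{i,-j}$, $\{b(i),b(j)\}=\{c(i),c(j)\}=0$, where $\{A,B\}=AB+BA$. The vacuum satisfies $b(m+1)|0\rangle=c(m)|0\rangle=0$ for $m\ge 0$; the dual vacuum satisfies $\langle 0|b(i+1)=\langle 0|c(i)=0$ for $i<0$. $\langle 0|a|0\rangle$ is the vacuum expectation value determined by these relations and $\langle 0|1|0\rangle=1$. For a fixed positive integer $M$, $$\mathbf B(x)=\exp(x\,b(-M+1)c(M-2))\exp(x\,b(-M+2)c(M-3))\cdots,$$ the ordered product of $\exp(x\,b(-(i-1))c(i-2))$, $i\le M$, with $i$ decreasing from left to right, and $$\mathbf C(x)=\cdots\exp(x\,b(-M+3)c(M-2))\exp(x\,b(-M+2)c(M-1)),$$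 the ordered product of $\exp(x\,b(-i+2)c(i-1))$, $i\le M$, with $i$ decreasing from right to left. On each fixed vector all but finitely many factors act as the identity. $s_\mu\{x\}$ is the Schur polynomial $\det(h_{\mu_i-i+j}(x_1,\dots,x_N))$, with $h_k$ the complete symmetric polynomials; $l(\mu)$ is the length of $\mu$. Limits in $M$ are coefficientwise. *)

theory Defs
  imports
    "HOL-Library.Poly_Mapping"
    "HOL-Library.Multiset"
    "HOL-Analysis.Infinite_Sum"
    "Jordan_Normal_Form.Determinant"
begin

section \<open>Formal power series in a set of variables\<close>

text \<open>
  A monomial in variables from \<open>'v\<close> is its finitely supported exponent vector, and a formal power
  series is an arbitrary family of coefficients indexed by monomials.
\<close>

typedef ('v, 'k) mps = "UNIV :: (('v \<Rightarrow>\<^sub>0 nat) \<Rightarrow> 'k) set"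
  morphisms coeff_mps Abs_mps ..

lemma coeff_Abs_mps [simp]: "coeff_mps (Abs_mps f) = f"
  by (simp add: Abs_mps_inverse)

lemma mps_eqI: "(\<And>m. coeff_mps f m = coeff_mps g m) \<Longrightarrow> f = g"
  by (simp add: coeff_mps_inject[symmetric] fun_eq_iff)

lemma finite_splits: "finite {(p, q). p + q = (m :: 'v \<Rightarrow>\<^sub>0 nat)}"
proof -
  define K where "K = Poly_Mapping.keys m"
  define F where "F = {f. \<forall>x. (x \<in> K \<longrightarrow> f x \<in> {..Max (Poly_Mapping.lookup m ` K)}) \<and> (x \<notin> K \<longrightarrow> f x = (0::nat))}"
  have fin: "finite F"
    unfolding F_def K_def by (rule finite_set_of_finite_funs[OF finite_keys finite_atMost])
  have sub: "Poly_Mapping.lookup p \<in> F" if "p + q = m" for p q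
  proof -
    have le: "Poly_Mapping.lookup p x \<le> Poly_Mapping.lookup m x" for x
      unfolding that[symmetric] Poly_Mapping.lookup_add by simp
    have "Poly_Mapping.lookup p x \<le> Max (Poly_Mapping.lookup m ` K)" if "x \<in> K" for x
      by (rule order_trans[OF le]) (use that in \<open>simp add: K_def\<close>)
    moreover have "Poly_Mapping.lookup p x = 0" if "x \<notin> K" for x
      using le[of x] that by (simp add: K_def Poly_Mapping.in_keys_iff)
    ultimately show ?thesis
      by (simp add: F_def)
  qed
  have "finite (Poly_Mapping.lookup -` F)"
    by (rule finite_vimageI[OF fin]) (simp add: inj_on_def)
  then have "finite ((Poly_Mapping.lookup -` F) \<times> (Poly_Mapping.lookup -` F))"
    by (intro finite_cartesian_product)
  moreover have "{(p, q). p + q = m} \<subseteq> (Poly_Mapping.lookup -` F) \<times> (Poly_Mapping.lookup -` F)"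
  proof
    fix z assume "z \<in> {(p, q). p + q = m}"
    then have "fst z + snd z = m" "snd z + fst z = m"
      by (auto simp: add.commute)
    then show "z \<in> (Poly_Mapping.lookup -` F) \<times> (Poly_Mapping.lookup -` F)"
      using sub by (simp add: mem_Times_iff)
  qed
  ultimately show ?thesis
    by (rule finite_subset[rotated])
qed

instantiation mps :: (type, comm_ring_1) comm_ring_1
begin

definition "0 = Abs_mps (\<lambda>m. 0)"
definition "1 = Abs_mps (\<lambda>m. if m = 0 then 1 else 0)"
definition "f + g = Abs_mps (\<lambda>m. coeff_mps f m + coeff_mps g m)"
definition "f - g = Abs_mps (\<lambda>m. coeff_mps f m - coeff_mps g m)"
definition "- f = Abs_mps (\<lambda>m. - coeff_mps f m)"
definition "f * g = Abs_mps (\<lambda>m. \<Sum>(p, q) | p + q = m. coeff_mps f p * coeff_mps g q)"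

lemmas mps_ring_defs =
  zero_mps_def one_mps_def plus_mps_def minus_mps_def uminus_mps_def times_mps_def

instance
proof
  fix f g h :: "('a, 'b) mps"
  show "f + g + h = f + (g + h)" "f + g = g + f" "0 + f = f" "- f + f = 0" "f - g = f + - g"
    by (simp_all add: mps_ring_defs algebra_simps)
      (simp_all add: coeff_mps_inverse)
  show "(0 :: ('a, 'b) mps) \<noteq> 1"
    by (auto simp: mps_ring_defs Abs_mps_inject fun_eq_iff intro!: exI[of _ 0])
  show "f * g = g * f"
    unfolding times_mps_def
    by (intro arg_cong[where f = Abs_mps] ext sum.reindex_bij_witness[of _ prod.swap prod.swap])
      (auto simp: add.commute mult.commute)
  show "1 * f = f"
  proof (rule mps_eqI)
    fix m
    have "(\<Sum>(p, q) | p + q = m. coeff_mps 1 p * coeff_mps f q)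
        = (\<Sum>(p, q) \<in> {(0, m)}. coeff_mps 1 p * coeff_mps f q)"
    proof (rule sum.mono_neutral_right[OF finite_splits])
      show "\<forall>z\<in>{(p, q). p + q = m} - {(0, m)}. (case z of (p, q) \<Rightarrow> coeff_mps 1 p * coeff_mps f q) = 0"
      proof
        fix z assume z: "z \<in> {(p, q). p + q = m} - {(0, m)}"
        have "fst z \<noteq> 0"
        proof
          assume "fst z = 0"
          with z have "z = (0, m)" by (simp add: case_prod_unfold prod_eq_iff)
          with z show False by simp
        qed
        then show "(case z of (p, q) \<Rightarrow> coeff_mps 1 p * coeff_mps f q) = 0"
          by (simp add: one_mps_def case_prod_unfold)
      qed
    qed simp
    then show "coeff_mps (1 * f) m = coeff_mps f m"
      by (simp add: times_mps_def) (simp add: one_mps_def)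
  qed
  show "(f + g) * h = f * h + g * h"
    by (simp add: times_mps_def plus_mps_def case_prod_unfold distrib_right sum.distrib)
  show "f * g * h = f * (g * h)"
  proof (rule mps_eqI)
    fix m
    let ?F = "coeff_mps f" and ?G = "coeff_mps g" and ?H = "coeff_mps h"
    have "coeff_mps (f * g * h) m
        = (\<Sum>(pq, r) | pq + r = m. \<Sum>(p, q) | p + q = pq. ?F p * ?G q * ?H r)"
      by (simp add: times_mps_def sum_distrib_right case_prod_unfold)
    also have "\<dots> = (\<Sum>((pq, r), (p, q)) \<in> (SIGMA z:{(pq, r). pq + r = m}. {(p, q). p + q = fst z}).
        ?F p * ?G q * ?H r)"
      by (subst sum.Sigma[symmetric]) (simp_all add: finite_splits finite_splits[unfolded case_prod_unfold] case_prod_unfold)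
    also have "\<dots> = (\<Sum>((p, qr), (q, r)) \<in> (SIGMA z:{(p, qr). p + qr = m}. {(q, r). q + r = snd z}).
        ?F p * (?G q * ?H r))"
      by (rule sum.reindex_bij_witness[of _
            "\<lambda>((p, qr), (q, r)). ((p + q, r), (p, q))" "\<lambda>((pq, r), (p, q)). ((p, q + r), (q, r))"])
        (auto simp: add.assoc mult.assoc)
    also have "\<dots> = (\<Sum>(p, qr) | p + qr = m. \<Sum>(q, r) | q + r = qr. ?F p * (?G q * ?H r))"
      by (subst sum.Sigma[symmetric]) (simp_all add: finite_splits finite_splits[unfolded case_prod_unfold] case_prod_unfold)
    also have "\<dots> = coeff_mps (f * (g * h)) m"
      by (simp add: times_mps_def sum_distrib_left case_prod_unfold)
    finally show "coeff_mps (f * g * h) m = coeff_mps (f * (g * h)) m" .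
  qed
qed

end

text \<open>The inverse of a non-unit is 0 by convention.\<close>

instantiation mps :: (type, comm_ring_1) inverse
begin

definition "inverse f = (if f dvd 1 then THE g. f * g = 1 else (0 :: ('a, 'b) mps))"
definition "f div g = f * inverse (g :: ('a, 'b) mps)"

instance ..

end

lemma mps_inverse_unique:
  fixes f g :: "('v, 'k :: comm_ring_1) mps"
  assumes "f * g = 1"
  shows "inverse f = g"
proof -
  have unique: "h = g" if "f * h = 1" for h
  proof -
    have "h = (f * g) * h"
      by (simp only: assms mult_1_left)
    also have "\<dots> = g * (f * h)"
      by (simp only: ac_simps)
    finally show ?thesis
      by (simp only: that mult_1_right)
  qed
  have "f dvd 1"
    unfolding dvd_def by (rule exI[of _ g]) (rule assms[symmetric])
  moreover have "(THE h. f * h = 1) = g"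
    by (rule the_equality[of "\<lambda>h. f * h = 1", OF assms unique])
  ultimately show ?thesis
    by (simp add: inverse_mps_def)
qed

text \<open>
  The topology of coefficientwise convergence: the product topology, where each coefficient
  carries the discrete topology.
\<close>

instantiation mps :: (type, type) topological_space
begin

definition "open (U :: ('a, 'b) mps set) \<longleftrightarrow>
  (\<forall>f\<in>U. \<exists>S. finite S \<and> (\<forall>g. (\<forall>m\<in>S. coeff_mps g m = coeff_mps f m) \<longrightarrow> g \<in> U))"

instance
proof
  show "open (UNIV :: ('a, 'b) mps set)"
    by (auto simp: open_mps_def)
next
  fix U V :: "('a, 'b) mps set"
  assume *: "open U" "open V"
  show "open (U \<inter> V)"
    unfolding open_mps_def
  proof
    fix f assume f: "f \<in> U \<inter> V"
    obtain S where "finite S" "\<forall>g. (\<forall>m\<in>S. coeff_mps g m = coeff_mps f m) \<longrightarrow> g \<in> U"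
      using *(1) f unfolding open_mps_def by (meson IntD1)
    moreover obtain T where "finite T" "\<forall>g. (\<forall>m\<in>T. coeff_mps g m = coeff_mps f m) \<longrightarrow> g \<in> V"
      using *(2) f unfolding open_mps_def by (meson IntD2)
    ultimately show "\<exists>S. finite S \<and> (\<forall>g. (\<forall>m\<in>S. coeff_mps g m = coeff_mps f m) \<longrightarrow> g \<in> U \<inter> V)"
      by (intro exI[of _ "S \<union> T"]) auto
  qed
next
  fix K :: "('a, 'b) mps set set"
  assume *: "\<forall>U\<in>K. open U"
  show "open (\<Union>K)"
    unfolding open_mps_def
  proof
    fix f assume "f \<in> \<Union>K"
    then obtain U where "U \<in> K" "f \<in> U" by blast
    with * obtain S where "finite S" "\<forall>g. (\<forall>m\<in>S. coeff_mps g m = coeff_mps f m) \<longrightarrow> g \<in> U"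
      unfolding open_mps_def by meson
    with \<open>U \<in> K\<close> show "\<exists>S. finite S \<and> (\<forall>g. (\<forall>m\<in>S. coeff_mps g m = coeff_mps f m) \<longrightarrow> g \<in> \<Union>K)"
      by (intro exI[of _ S]) auto
  qed
qed

end

lemma open_mps_cylinder: "open {g :: ('v, 'k) mps. coeff_mps g m = a}"
  unfolding open_mps_def by (auto intro!: exI[of _ "{m}"])

instance mps :: (type, type) t2_space
proof
  fix f g :: "('a, 'b) mps"
  assume "f \<noteq> g"
  then obtain m where m: "coeff_mps f m \<noteq> coeff_mps g m"
    using mps_eqI by blast
  show "\<exists>U V. open U \<and> open V \<and> f \<in> U \<and> g \<in> V \<and> U \<inter> V = {}"
    by (intro exI[of _ "{h. coeff_mps h m = coeff_mps f m}"]
        exI[of _ "{h. coeff_mps h m = coeff_mps g m}"])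
      (use m in \<open>auto simp: open_mps_cylinder\<close>)
qed

lemma tendsto_mps_iff:
  "(F \<longlongrightarrow> (L :: ('v, 'k) mps)) net \<longleftrightarrow>
    (\<forall>m. \<forall>\<^sub>F z in net. coeff_mps (F z) m = coeff_mps L m)"
proof (intro iffI allI)
  fix m assume "(F \<longlongrightarrow> L) net"
  from topological_tendstoD[OF this open_mps_cylinder[of m "coeff_mps L m"]]
  show "\<forall>\<^sub>F z in net. coeff_mps (F z) m = coeff_mps L m" by simp
next
  assume *: "\<forall>m. \<forall>\<^sub>F z in net. coeff_mps (F z) m = coeff_mps L m"
  show "(F \<longlongrightarrow> L) net"
  proof (rule topological_tendstoI)
    fix U assume "open U" "L \<in> U"
    then obtain S where S: "finite S" "\<forall>g. (\<forall>m\<in>S. coeff_mps g m = coeff_mps L m) \<longrightarrow> g \<in> U"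
      unfolding open_mps_def by meson
    have "\<forall>\<^sub>F z in net. \<forall>m\<in>S. coeff_mps (F z) m = coeff_mps L m"
      using * S(1) by (simp add: eventually_ball_finite)
    then show "\<forall>\<^sub>F z in net. F z \<in> U"
      by (rule eventually_mono) (use S(2) in blast)
  qed
qed

definition const_mps :: "'k \<Rightarrow> ('v, 'k :: comm_ring_1) mps" where
  "const_mps a = Abs_mps (\<lambda>m. if m = 0 then a else 0)"

definition var_mps :: "'v \<Rightarrow> ('v, 'k :: comm_ring_1) mps" where
  "var_mps v = Abs_mps (\<lambda>m. if m = Poly_Mapping.single v 1 then 1 else 0)"

datatype xy_var = X nat | Y nat

section \<open>Partitions and Schur polynomials\<close>

text \<open>A partition is the list of its positive parts, so its length is the length of the list.\<close>

definition is_partition :: "nat list \<Rightarrow> bool" where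
  "is_partition \<mu> \<longleftrightarrow> sorted_wrt (\<ge>) \<mu> \<and> (\<forall>p\<in>set \<mu>. 0 < p)"

definition complete_sym :: "nat \<Rightarrow> (nat \<Rightarrow> 'a :: comm_ring_1) \<Rightarrow> int \<Rightarrow> 'a" where
  "complete_sym N x k =
    (if k < 0 then 0 else \<Sum>A\<in>multisets_of_size {1..N} (nat k). \<Prod>i\<in>#A. x i)"

text \<open>Rows and columns of the matrix are indexed from 0, which does not change \<open>\<mu>\<^sub>i - i + j\<close>.\<close>

definition schur :: "nat \<Rightarrow> (nat \<Rightarrow> 'a :: comm_ring_1) \<Rightarrow> nat list \<Rightarrow> 'a" where
  "schur N x \<mu> = Determinant.det (mat (length \<mu>) (length \<mu>)
    (\<lambda>(i, j). complete_sym N x (int (\<mu> ! i) - int i + int j)))"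

section \<open>Charged fermions\<close>

text \<open>
  A representation of the fermion modes by linear operators on a module over a commutative ring,
  with a vacuum vector \<open>vac\<close> and a dual vacuum \<open>dvac\<close>, a linear form. The vacuum expectation value
  of an operator \<open>a\<close> is \<open>dvac (a vac)\<close>.
\<close>

locale fermions =
  Modules.module scal for scal :: "'r :: comm_ring_1 \<Rightarrow> 'e :: ab_group_add \<Rightarrow> 'e" +
  fixes b c :: "int \<Rightarrow> 'e \<Rightarrow> 'e" and vac :: 'e and dvac :: "'e \<Rightarrow> 'r"
  assumes linear_b: "Modules.module_hom scal scal (b i)"
    and linear_c: "Modules.module_hom scal scal (c i)"
    and linear_dvac: "Modules.module_hom scal (*) dvac"
    and anticomm_bc: "b i (c j v) + c j (b i v) = (if i = - j then v else 0)"
    and anticomm_bb: "b i (b j v) + b j (b i v) = 0"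
    and anticomm_cc: "c i (c j v) + c j (c i v) = 0"
    and vac_b: "m \<ge> 0 \<Longrightarrow> b (m + 1) vac = 0"
    and vac_c: "m \<ge> 0 \<Longrightarrow> c m vac = 0"
    and dvac_b: "i < 0 \<Longrightarrow> dvac (b (i + 1) v) = 0"
    and dvac_c: "i < 0 \<Longrightarrow> dvac (c i v) = 0"
    and dvac_vac: "dvac vac = 1"

text \<open>
  The exponential of a locally nilpotent operator on a module over a power series ring; the sum
  ranges over the finitely many nonzero terms.
\<close>

definition op_exp ::
  "(('v, 'k :: field_char_0) mps \<Rightarrow> 'e :: ab_group_add \<Rightarrow> 'e) \<Rightarrow> ('e \<Rightarrow> 'e) \<Rightarrow> 'e \<Rightarrow> 'e" where
  "op_exp scal A v = Sum_any (\<lambda>k. scal (const_mps (1 / fact k)) ((A ^^ k) v))"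

text \<open>
  The value at \<open>v\<close> of an infinite product is the eventually constant value, as \<open>L\<close> tends to
  \<open>-\<infinity>\<close>, of the products of the factors with indices \<open>L \<le> i \<le> M\<close>.
\<close>

definition eventual_value :: "(int \<Rightarrow> 'e) \<Rightarrow> 'e" where
  "eventual_value f = (THE w. \<forall>\<^sub>F L in at_bot. f L = w)"

text \<open>
  \<open>fold F [L..M]\<close> is \<open>F M \<circ> \<dots> \<circ> F L\<close> (indices decrease from left to right) and
  \<open>foldr F [L..M]\<close> is \<open>F L \<circ> \<dots> \<circ> F M\<close> (indices decrease from right to left).
\<close>

definition fermion_B ::
  "(('v, 'k :: field_char_0) mps \<Rightarrow> 'e :: ab_group_add \<Rightarrow> 'e) \<Rightarrow>
    (int \<Rightarrow> 'e \<Rightarrow> 'e) \<Rightarrow> (int \<Rightarrow> 'e \<Rightarrow> 'e) \<Rightarrow> nat \<Rightarrow> ('v, 'k) mps \<Rightarrow> 'e \<Rightarrow> 'e" where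
  "fermion_B scal b c M x v = eventual_value (\<lambda>L.
    fold (\<lambda>i. op_exp scal (\<lambda>u. scal x (b (- (i - 1)) (c (i - 2) u)))) [L..int M] v)"

definition fermion_C ::
  "(('v, 'k :: field_char_0) mps \<Rightarrow> 'e :: ab_group_add \<Rightarrow> 'e) \<Rightarrow>
    (int \<Rightarrow> 'e \<Rightarrow> 'e) \<Rightarrow> (int \<Rightarrow> 'e \<Rightarrow> 'e) \<Rightarrow> nat \<Rightarrow> ('v, 'k) mps \<Rightarrow> 'e \<Rightarrow> 'e" where
  "fermion_C scal b c M x v = eventual_value (\<lambda>L.
    foldr (\<lambda>i. op_exp scal (\<lambda>u. scal x (b (- i + 2) (c (i - 1) u)))) [L..int M] v)"

text \<open>\<open>\<langle>0| C(x\<^sub>N) \<cdots> C(x\<^sub>1) B(y\<^sub>1) \<cdots> B(y\<^sub>N) |0\<rangle>\<close>\<close>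

definition CB_vev ::
  "(('v, 'k :: field_char_0) mps \<Rightarrow> 'e :: ab_group_add \<Rightarrow> 'e) \<Rightarrow>
    (int \<Rightarrow> 'e \<Rightarrow> 'e) \<Rightarrow> (int \<Rightarrow> 'e \<Rightarrow> 'e) \<Rightarrow> 'e \<Rightarrow> ('e \<Rightarrow> ('v, 'k) mps) \<Rightarrow>
    nat \<Rightarrow> nat \<Rightarrow> (nat \<Rightarrow> ('v, 'k) mps) \<Rightarrow> (nat \<Rightarrow> ('v, 'k) mps) \<Rightarrow> ('v, 'k) mps" where
  "CB_vev scal b c vac dvac M N x y = dvac
    (fold (\<lambda>i. fermion_C scal b c M (x i)) [1..<N + 1]
      (foldr (\<lambda>j. fermion_B scal b c M (y j)) [1..<N + 1] vac))"

end

theory Submission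
  imports Defs "HOL-Computational_Algebra.Formal_Power_Series"
begin

text \<open>
  A partition \<open>\<mu>\<close> is treated as a weakly decreasing function on the naturals that is eventually zero, and
  it labels the state in which the particles of the Dirac sea sit at the positions \<open>i + 1 - \<mu>\<^sub>i\<close>
  (\<open>slater\<close>); the empty partition labels the vacuum, whose particles fill the positions \<open>1, 2, \<dots>\<close>.
  A factor \<open>exp (x b c)\<close> of \<open>B(x)\<close> moves one particle one position to the left, and the factors are
  ordered so that a particle just moved may be moved on by the next factor. Being the exponential of
  a bilinear operator, each factor acts on every particle separately, so that
  \<open>B(x) b(p) = (\<Sum>\<^sub>k x\<^sup>k b(p - k)) B(x)\<close> (\<open>trunc_B_b\<close>),
  where \<open>k\<close> runs until the position \<open>1 - M\<close> is reached. Hence \<open>B(x)\<close> turns a state into a product of such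
  sums, each of which contains a multiple of its left neighbour. A sum of creation operators squares
  to zero, so these multiples can be removed, and what is left lets a particle travel only through
  the positions that were empty between it and its left neighbour. In terms of
  partitions, \<open>B(x)\<close> maps \<open>\<mu>\<close> to the sum of \<open>x\<^bsup>|\<nu>| - |\<mu>|\<^esup> \<nu>\<close> over all \<open>\<nu>\<close> with first part at most \<open>M\<close> for which
  \<open>\<nu>/\<mu>\<close> is a horizontal strip (\<open>trunc_B_slater\<close>), and \<open>C(x)\<close> is adjoint to it (\<open>trunc_C_slater\<close>).
  Iterating, the expectation value is \<open>\<Sum>\<^sub>\<mu> S\<^sub>\<mu>(x) S\<^sub>\<mu>(y)\<close> over the partitions in the box, where \<open>S\<close>
  (\<open>branch_schur\<close>) adds up the weights of all chains of horizontal strips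
  from the empty partition to \<open>\<mu>\<close>.

  That \<open>S\<^sub>\<mu>\<close> is the Jacobi--Trudi determinant is the same cancellation once more: the rows of the
  determinant in the variables \<open>x # xs\<close> are sums of rows in the variables \<open>xs\<close>, subtracting from each row a
  multiple of the next one cuts these sums down to finite windows, and expanding by multilinearity
  gives the branching rule (\<open>det_jacobi_trudi\<close>).

  The Cauchy identity rests on the Pieri rule: \<open>h\<^sub>r S\<^sub>\<nu>\<close> is the sum of all \<open>S\<^sub>\<mu>\<close> for which \<open>\<mu>/\<nu>\<close> is a
  horizontal strip of size \<open>r\<close> (\<open>pieri\<close>). It is proved by induction on the number of variables; the
  step exchanges the order of adding and of removing a strip, by a bijection
  that reflects each part in the interval in which it may vary.
  The Pieri rule adjoins one variable \<open>y\<close> at a time to \<open>\<Sum>\<^sub>\<mu> S\<^sub>\<mu>(x) S\<^sub>\<mu>(y) t\<^bsup>|\<mu>|\<^esup>\<close>, which is therefore the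
  product of all \<open>1/(1 - x\<^sub>i y\<^sub>j t)\<close> (\<open>fps_cauchy_part\<close>). Since \<open>S\<^sub>\<mu>(y)\<close> is homogeneous of degree \<open>|\<mu>|\<close>, a
  monomial occurs only in the terms whose \<open>|\<mu>|\<close> is its degree in the \<open>y\<close> variables.
  So \<open>t\<close> may be set to 1, and each coefficient of the partial sums
  becomes stationary, which gives both the limit in \<open>M\<close> and the infinite sum.
\<close>

section \<open>Complete symmetric polynomials\<close>

text \<open>
  The variables form a list so that they can be removed one at a time; the degree is an integer
  because the entries of the Jacobi--Trudi matrix may have negative degree.
\<close>

primrec hom_sym :: "'a::comm_ring_1 list \<Rightarrow> int \<Rightarrow> 'a" where
  "hom_sym [] k = (if k = 0 then 1 else 0)"
| "hom_sym (x # xs) k = (\<Sum>r\<le>nat k. x ^ r * hom_sym xs (k - int r))"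

lemma hom_sym_neg: "k < 0 \<Longrightarrow> hom_sym xs k = 0"
  by (induction xs) auto

lemma hom_sym_rec: "hom_sym (x # xs) k = hom_sym xs k + x * hom_sym (x # xs) (k - 1)"
proof (cases "k \<le> 0")
  case True
  then show ?thesis by (simp add: hom_sym_neg)
next
  case False
  then have k: "nat k = Suc (nat (k - 1))" by simp
  have "hom_sym (x # xs) k = (\<Sum>r\<le>Suc (nat (k - 1)). x ^ r * hom_sym xs (k - int r))"
    by (simp only: hom_sym.simps k)
  also have "\<dots> = hom_sym xs k + x * hom_sym (x # xs) (k - 1)"
    by (subst sum.atMost_Suc_shift) (simp add: sum_distrib_left algebra_simps)
  finally show ?thesis .
qed

lemma hom_sym_unroll:
  "hom_sym (x # xs) k = (\<Sum>r<a. x ^ r * hom_sym xs (k - int r)) + x ^ a * hom_sym (x # xs) (k - int a)"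
proof (induction a)
  case (Suc a)
  show ?case
    by (subst Suc, subst hom_sym_rec[of x xs "k - int a"]) (simp add: algebra_simps del: hom_sym.simps)
qed simp

lemma sum_multisets_of_size_eq_hom_sym:
  "distinct is \<Longrightarrow>
    (\<Sum>A\<in>multisets_of_size (set is) n. \<Prod>i\<in>#A. x i) = hom_sym (map x is) (int n)"
proof (induction "is" arbitrary: n)
  case (Cons i "is")
  have IH: "(\<Sum>A\<in>multisets_of_size (set is) m. \<Prod>i\<in>#A. x i) = hom_sym (map x is) (int m)" for m
    using Cons by simp
  have "(\<Sum>A\<in>multisets_of_size (insert i (set is)) n. \<Prod>i\<in>#A. x i)
      = (\<Sum>(r, A)\<in>(SIGMA r:{0..n}. multisets_of_size (set is) (n - r)). \<Prod>i\<in>#A + replicate_mset r i. x i)"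
    using Cons.prems
    by (subst sum.reindex_bij_betw[OF bij_betw_multisets_of_size_insert, symmetric])
      (auto simp: case_prod_unfold)
  also have "\<dots> = (\<Sum>r=0..n. \<Sum>A\<in>multisets_of_size (set is) (n - r). x i ^ r * (\<Prod>i\<in>#A. x i))"
    by (subst sum.Sigma) (auto simp: finite_multisets_of_size mult.commute)
  also have "\<dots> = (\<Sum>r=0..n. x i ^ r * hom_sym (map x is) (int (n - r)))"
    by (simp only: IH sum_distrib_left[symmetric])
  also have "\<dots> = hom_sym (map x (i # is)) (int n)"
    by (auto simp: atLeast0AtMost of_nat_diff intro!: sum.cong)
  finally show ?case by simp
qed (cases n; auto)

lemma complete_sym_eq_hom_sym: "complete_sym N x k = hom_sym (map x [1..<N + 1]) k"
proof (cases "k < 0")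
  case False
  moreover have "{1..N} = set [1..<N + 1]" by auto
  ultimately show ?thesis
    by (simp only: complete_sym_def if_False sum_multisets_of_size_eq_hom_sym distinct_upt) simp
qed (simp add: complete_sym_def hom_sym_neg)

text \<open>
  Complete symmetric polynomials in \<open>xs\<close> over a window of degrees combine into a difference of only
  two in \<open>x # xs\<close>. With \<open>d = j - i\<close>, this difference is what a row operation produces from two
  consecutive rows of the Jacobi--Trudi matrix.
\<close>

lemma hom_sym_window:
  assumes "l \<le> m"
  shows "(\<Sum>q\<in>{l..m}. x ^ (m - q) * hom_sym xs (int q + d)) =
    hom_sym (x # xs) (int m + d) - x ^ (Suc m - l) * hom_sym (x # xs) (int l + d - 1)"
proof -
  have window: "(\<Sum>q\<in>{l..m}. x ^ (m - q) * hom_sym xs (int q + d))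
      = (\<Sum>r<Suc m - l. x ^ r * hom_sym xs (int m + d - int r))"
    by (rule sum.reindex_bij_witness[of _ "\<lambda>r. m - r" "\<lambda>q. m - q"])
      (use assms in \<open>auto simp: of_nat_diff algebra_simps\<close>)
  have shift: "int m + d - int (Suc m - l) = int l + d - 1"
    using assms by (simp add: of_nat_diff)
  show ?thesis
    unfolding window hom_sym_unroll[of x xs "int m + d" "Suc m - l", unfolded shift] by (rule add_diff_cancel_right'[symmetric])
qed

section \<open>Interlacing partitions\<close>

text \<open>
  For eventually vanishing functions this says that \<open>\<nu> \<subseteq> \<mu>\<close> are partitions and \<open>\<mu>/\<nu>\<close> is a horizontal strip;
  the monotonicity of both is implied.
\<close>

definition interlaces :: "(nat \<Rightarrow> nat) \<Rightarrow> (nat \<Rightarrow> nat) \<Rightarrow> bool" where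
  "interlaces \<nu> \<mu> \<longleftrightarrow> (\<forall>i. \<mu> (Suc i) \<le> \<nu> i \<and> \<nu> i \<le> \<mu> i)"

definition has_rows :: "nat \<Rightarrow> (nat \<Rightarrow> nat) \<Rightarrow> bool" where
  "has_rows n \<mu> \<longleftrightarrow> (\<forall>i\<ge>n. \<mu> i = 0)"

definition weight :: "(nat \<Rightarrow> nat) \<Rightarrow> nat" where
  "weight \<mu> = Sum_any \<mu>"

lemma interlaces_antimono:
  assumes "interlaces \<nu> \<mu>"
  shows "antimono \<nu>" "antimono \<mu>"
proof -
  have "\<mu> (Suc i) \<le> \<nu> i" "\<nu> i \<le> \<mu> i" for i
    using assms by (auto simp: interlaces_def)
  then show "antimono \<nu>" "antimono \<mu>"
    unfolding antimono_iff_le_Suc by (blast intro: le_trans)+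
qed

lemma interlaces_rows:
  assumes "interlaces \<nu> \<mu>"
  shows "has_rows n \<mu> \<Longrightarrow> has_rows n \<nu>" "has_rows n \<nu> \<Longrightarrow> has_rows (Suc n) \<mu>"
proof -
  have *: "\<mu> (Suc i) \<le> \<nu> i" "\<nu> i \<le> \<mu> i" for i
    using assms by (auto simp: interlaces_def)
  show "has_rows n \<mu> \<Longrightarrow> has_rows n \<nu>"
    unfolding has_rows_def using *(2) by (metis le_zero_eq)
  show "has_rows (Suc n) \<mu>" if "has_rows n \<nu>"
    unfolding has_rows_def
  proof (intro allI impI)
    fix i assume "Suc n \<le> i"
    then obtain k where "i = Suc k" "n \<le> k" by (cases i) auto
    with *(1)[of k] that show "\<mu> i = 0" by (simp add: has_rows_def)
  qed
qed

lemma rows_mono: "has_rows n \<mu> \<Longrightarrow> n \<le> m \<Longrightarrow> has_rows m \<mu>"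
  by (simp add: has_rows_def)

lemma antimono_rows_iff: "antimono \<mu> \<Longrightarrow> has_rows n \<mu> \<longleftrightarrow> \<mu> n = 0"
  unfolding has_rows_def using antimonoD[of \<mu> n] by fastforce

lemma weight_eq: "has_rows n \<mu> \<Longrightarrow> weight \<mu> = (\<Sum>i<n. \<mu> i)"
  unfolding weight_def has_rows_def
  by (rule Sum_any.expand_superset) (simp, metis (mono_tags, lifting) lessThan_iff linorder_not_le mem_Collect_eq subsetI)

lemma interlaces_weight: "interlaces \<nu> \<mu> \<Longrightarrow> has_rows n \<mu> \<Longrightarrow> weight \<nu> \<le> weight \<mu>"
  using interlaces_rows(1)[of \<nu> \<mu> n]
  by (simp add: weight_eq[of n] interlaces_def sum_mono)

lemma weight_ge_part: "has_rows n \<mu> \<Longrightarrow> \<mu> i \<le> weight \<mu>"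
  by (cases "i < n") (auto simp: weight_eq has_rows_def intro: member_le_sum)

lemma finite_bounded_rows: "finite {\<mu>. has_rows n \<mu> \<and> (\<forall>i. \<mu> i \<le> B)}"
proof (rule finite_subset)
  show "finite {f. \<forall>x. (x \<in> {..<n} \<longrightarrow> f x \<in> {..B}) \<and> (x \<notin> {..<n} \<longrightarrow> f x = (0::nat))}"
    by (rule finite_set_of_finite_funs) auto
qed (auto simp: has_rows_def)

lemma finite_interlaces_below: 
  assumes "has_rows n \<mu>" shows "finite {\<nu>. interlaces \<nu> \<mu>}"
proof (rule finite_subset[OF _ finite_bounded_rows[of n "weight \<mu>"]])
  show "{\<nu>. interlaces \<nu> \<mu>} \<subseteq> {\<nu>. has_rows n \<nu> \<and> (\<forall>i. \<nu> i \<le> weight \<mu>)}"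
    using assms interlaces_rows weight_ge_part[OF assms] 
    by (auto simp: interlaces_def intro: le_trans)
qed

lemma finite_interlaces_above: 
  assumes "has_rows n \<nu>" shows "finite {\<mu>. interlaces \<nu> \<mu> \<and> weight \<mu> = w}"
  by (rule finite_subset[OF _ finite_bounded_rows[of "Suc n" w]])
    (use interlaces_rows(2)[OF _ assms] weight_ge_part in auto)

definition box :: "nat \<Rightarrow> nat \<Rightarrow> (nat \<Rightarrow> nat) set" where
  "box N M = {\<mu>. antimono \<mu> \<and> has_rows N \<mu> \<and> \<mu> 0 \<le> M}"

lemma finite_box: "finite (box N M)"
  by (rule finite_subset[OF _ finite_bounded_rows[of N M]])
    (auto simp: box_def intro: order_trans[OF antimonoD[OF _ le0]])

lemma box_0: "box 0 M = {\<lambda>_. 0}"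
  by (auto simp: box_def has_rows_def antimono_def)

lemma interlaces_below_box:
  assumes "\<mu> \<in> box N M"
  shows "{\<nu>. interlaces \<nu> \<mu>} = {\<nu> \<in> box N M. interlaces \<nu> \<mu>}"
  using assms interlaces_antimono(1) interlaces_rows(1)
  by (auto simp: box_def interlaces_def intro: order_trans)

text \<open>
  Choosing one value per row, as in the expansion of a product of sums, amounts to
  choosing a function that is continued by zero.
\<close>

lemma sum_PiE_rows:
  fixes S :: "nat \<Rightarrow> nat set"
  assumes "\<And>f g. (\<And>i. i < n \<Longrightarrow> f i = g i) \<Longrightarrow> F f = F g"
  shows "(\<Sum>f\<in>PiE {..<n} S. F f) = (\<Sum>\<nu> | has_rows n \<nu> \<and> (\<forall>i<n. \<nu> i \<in> S i). F \<nu>)"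
  by (rule sum.reindex_bij_witness[of _ "\<lambda>\<nu>. restrict \<nu> {..<n}" "\<lambda>f i. if i < n then f i else 0"])
    (auto simp: fun_eq_iff PiE_def extensional_def has_rows_def intro: assms)

lemma interlaces_below_eq:
  assumes "has_rows n \<mu>"
  shows "{\<nu>. has_rows n \<nu> \<and> (\<forall>i<n. \<nu> i \<in> {\<mu> (Suc i)..\<mu> i})} = {\<nu>. interlaces \<nu> \<mu>}"
proof (rule antisym; rule subsetI)
  fix \<nu> assume *: "\<nu> \<in> {\<nu>. has_rows n \<nu> \<and> (\<forall>i<n. \<nu> i \<in> {\<mu> (Suc i)..\<mu> i})}"
  have "\<mu> (Suc i) \<le> \<nu> i \<and> \<nu> i \<le> \<mu> i" for i
    using * assms by (cases "i < n") (auto simp: has_rows_def)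
  then show "\<nu> \<in> {\<nu>. interlaces \<nu> \<mu>}" by (simp add: interlaces_def)
next
  fix \<nu> assume "\<nu> \<in> {\<nu>. interlaces \<nu> \<mu>}"
  then show "\<nu> \<in> {\<nu>. has_rows n \<nu> \<and> (\<forall>i<n. \<nu> i \<in> {\<mu> (Suc i)..\<mu> i})}"
    using interlaces_rows(1)[OF _ assms] by (auto simp: interlaces_def)
qed

lemma prod_power_interlaces:
  fixes x :: "'a :: comm_ring_1"
  assumes "interlaces \<nu> \<mu>" "has_rows n \<mu>"
  shows "(\<Prod>i<n. x ^ (\<mu> i - \<nu> i)) = x ^ (weight \<mu> - weight \<nu>)"
proof -
  have "has_rows n \<nu>" using assms interlaces_rows by blast
  moreover have "\<And>i. \<nu> i \<le> \<mu> i" using assms(1) by (simp add: interlaces_def)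
  ultimately show ?thesis
    using assms(2) by (simp add: weight_eq[of n] power_sum[symmetric] sum_subtractf_nat)
qed

lemma interlaces_above_eq:
  assumes "has_rows k \<mu>" "k < n"
  shows "{\<nu>. has_rows n \<nu> \<and> (\<forall>i<n. \<nu> i \<in> {\<mu> i..(case i of 0 \<Rightarrow> M | Suc j \<Rightarrow> \<mu> j)})}
    = {\<nu>. interlaces \<mu> \<nu> \<and> \<nu> 0 \<le> M}" (is "?A = ?B")
proof (rule antisym; rule subsetI)
  fix \<nu> assume *: "\<nu> \<in> ?A"
  have "\<nu> (Suc i) \<le> \<mu> i" for i
    using * by (cases "Suc i < n") (auto simp: has_rows_def split: nat.splits)
  moreover have "\<mu> i \<le> \<nu> i" for i
    using * assms by (cases "i < n") (auto simp: has_rows_def)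
  moreover have "\<nu> 0 \<le> M" using * assms(2) by force
  ultimately show "\<nu> \<in> ?B" by (simp add: interlaces_def)
next
  fix \<nu> assume *: "\<nu> \<in> ?B"
  then have "has_rows n \<nu>" using rows_mono[OF interlaces_rows(2)[OF _ assms(1)] Suc_leI[OF assms(2)]] by blast
  with * show "\<nu> \<in> ?A" by (auto simp: interlaces_def split: nat.splits)
qed

section \<open>Schur polynomials by branching and the Jacobi--Trudi determinant\<close>

text \<open>
  The generating function of the chains of horizontal strips from the empty
  partition to \<open>\<mu>\<close>, that is, of the semistandard tableaux of shape \<open>\<mu>\<close>.
\<close>

primrec branch_schur :: "'a::comm_ring_1 list \<Rightarrow> (nat \<Rightarrow> nat) \<Rightarrow> 'a" where
  "branch_schur [] \<mu> = (if \<mu> = (\<lambda>_. 0) then 1 else 0)"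
| "branch_schur (x # xs) \<mu> =
    (\<Sum>\<nu> | interlaces \<nu> \<mu>. x ^ (weight \<mu> - weight \<nu>) * branch_schur xs \<nu>)"

lemma branch_schur_zero: "branch_schur xs (\<lambda>_. 0) = 1"
proof (induction xs)
  case (Cons x xs)
  have "{\<nu>. interlaces \<nu> (\<lambda>_. 0)} = {\<lambda>_. 0}"
    by (auto simp: interlaces_def)
  with Cons show ?case by simp
qed simp

text \<open>
  A horizontal strip adds at most one row, so a shape with more rows than there are variables
  has no tableaux.
\<close>

lemma branch_schur_length: "branch_schur xs \<mu> \<noteq> 0 \<Longrightarrow> \<mu> (length xs) = 0"
proof (induction xs arbitrary: \<mu>)
  case (Cons x xs)
  from Cons.prems obtain \<nu> where "interlaces \<nu> \<mu>"
    and "x ^ (weight \<mu> - weight \<nu>) * branch_schur xs \<nu> \<noteq> 0"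
    by (auto elim: sum.not_neutral_contains_not_neutral)
  then have "interlaces \<nu> \<mu>" "branch_schur xs \<nu> \<noteq> 0" by auto
  with Cons.IH[of \<nu>] show ?case
    by (metis interlaces_def le_zero_eq length_Cons)
qed (auto split: if_splits)

text \<open>
  Multilinearity of the determinant in its rows, read off from the Leibniz formula.
\<close>

lemma det_mat_row_sums:
  fixes a :: "nat \<Rightarrow> 'b \<Rightarrow> 'a :: comm_ring_1"
  assumes "\<And>i. i < n \<Longrightarrow> finite (S i)"
  shows "Determinant.det (mat n n (\<lambda>(i, j). \<Sum>m\<in>S i. a i m * g i m j))
    = (\<Sum>f\<in>PiE {..<n} S. (\<Prod>i<n. a i (f i)) * Determinant.det (mat n n (\<lambda>(i, j). g i (f i) j)))"
proof -
  have perm: "p i < n" if "p permutes {0..<n}" "i < n" for p i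
    using permutes_in_image[OF that(1), of i] that(2) by simp
  have "Determinant.det (mat n n (\<lambda>(i, j). \<Sum>m\<in>S i. a i m * g i m j))
    = (\<Sum>p | p permutes {0..<n}. of_int (sign p) * (\<Prod>i<n. \<Sum>m\<in>S i. a i m * g i m (p i)))"
    by (auto simp: Determinant.det_def perm atLeast0LessThan intro!: sum.cong prod.cong)
  also have "\<dots> = (\<Sum>p | p permutes {0..<n}. \<Sum>f\<in>PiE {..<n} S.
       (\<Prod>i<n. a i (f i)) * (of_int (sign p) * (\<Prod>i<n. g i (f i) (p i))))"
    by (subst prod_sum_PiE) (auto simp: assms sum_distrib_left prod.distrib mult_ac intro!: sum.cong)
  also have "\<dots> = (\<Sum>f\<in>PiE {..<n} S. (\<Prod>i<n. a i (f i)) * Determinant.det (mat n n (\<lambda>(i, j). g i (f i) j)))"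
    by (subst sum.swap)
      (auto simp: Determinant.det_def perm atLeast0LessThan sum_distrib_left intro!: sum.cong prod.cong)
  finally show ?thesis .
qed

definition jacobi_trudi :: "nat \<Rightarrow> 'a::comm_ring_1 list \<Rightarrow> (nat \<Rightarrow> nat) \<Rightarrow> 'a mat" where
  "jacobi_trudi n xs \<mu> = mat n n (\<lambda>(i, j). hom_sym xs (int (\<mu> i) - int i + int j))"

text \<open>
  By \<open>hom_sym_window\<close>, subtracting from each row a suitable multiple of the next one turns row \<open>i\<close> into a
  combination of rows in the variables \<open>xs\<close> whose parts run from \<open>\<mu>\<^sub>i\<^sub>+\<^sub>1\<close> to \<open>\<mu>\<^sub>i\<close>. Multilinearity then
  produces exactly the interlacing \<open>\<nu>\<close>.
\<close>

lemma det_jacobi_trudi_Cons: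
  assumes "antimono \<mu>" "has_rows n \<mu>"
  shows "Determinant.det (jacobi_trudi n (x # xs) \<mu>) =
    (\<Sum>\<nu> | interlaces \<nu> \<mu>. x ^ (weight \<mu> - weight \<nu>) * Determinant.det (jacobi_trudi n xs \<nu>))"
proof -
  define A where "A = jacobi_trudi n (x # xs) \<mu>"
  define U where "U = mat n n (\<lambda>(i, k). if k = i then 1
    else if k = Suc i then - (x ^ (Suc (\<mu> i) - \<mu> (Suc i))) else 0)"
  define D where "D = mat n n (\<lambda>(i, j). \<Sum>m\<in>{\<mu> (Suc i)..\<mu> i}. x ^ (\<mu> i - m) * hom_sym xs (int m - int i + int j))"
  have dec: "\<mu> (Suc i) \<le> \<mu> i" for i using assms(1) by (simp add: antimono_iff_le_Suc)
  have A: "A \<in> carrier_mat n n" and U: "U \<in> carrier_mat n n"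
    by (simp_all add: A_def U_def jacobi_trudi_def)
  have "U * A = D"
  proof (rule eq_matI)
    fix i j assume "i < dim_row D" "j < dim_col D"
    then have ij: "i < n" "j < n" by (auto simp: D_def)
    let ?H = "\<lambda>k. hom_sym (x # xs) (int (\<mu> k) - int k + int j)"
    have "(U * A) $$ (i, j) = (\<Sum>k<n. U $$ (i, k) * A $$ (k, j))"
      using ij by (simp add: U_def A_def jacobi_trudi_def scalar_prod_def atLeast0LessThan)
    also have "\<dots> = (\<Sum>k<n. (if k = i then ?H k else 0)
         + (if k = Suc i then - (x ^ (Suc (\<mu> i) - \<mu> (Suc i))) * ?H k else 0))"
      by (rule sum.cong) (use ij in \<open>auto simp: U_def A_def jacobi_trudi_def\<close>)
    also have "\<dots> = ?H i - (if Suc i < n then x ^ (Suc (\<mu> i) - \<mu> (Suc i)) * ?H (Suc i) else 0)"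
      using ij by (simp add: sum.distrib del: hom_sym.simps)
    \<comment> \<open>Row \<open>n\<close> of the matrix does not exist, but its entries would have negative degree and vanish.\<close>
    also have "\<dots> = ?H i - x ^ (Suc (\<mu> i) - \<mu> (Suc i)) * ?H (Suc i)"
    proof (cases "Suc i < n")
      case False
      with ij assms(2) have "?H (Suc i) = 0"
        by (intro hom_sym_neg) (auto simp: has_rows_def)
      then show ?thesis by (simp del: hom_sym.simps)
    qed simp
    also have "\<dots> = D $$ (i, j)"
      using hom_sym_window[OF dec, of x i xs "int j - int i"] ij
      by (simp add: D_def algebra_simps del: hom_sym.simps)
    finally show "(U * A) $$ (i, j) = D $$ (i, j)" .
  qed (simp_all add: U_def A_def D_def jacobi_trudi_def)
  moreover have "Determinant.det U = 1"
  proof -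
    have "upper_triangular U" by (auto simp: U_def upper_triangular_def)
    moreover have "diag_mat U = map (\<lambda>_. 1) [0..<n]" by (auto simp: diag_mat_def U_def)
    ultimately show ?thesis using U by (simp add: det_upper_triangular map_replicate_const)
  qed
  ultimately have "Determinant.det A = Determinant.det D"
    using det_mult[OF U A] by simp
  also have "\<dots> = (\<Sum>f\<in>PiE {..<n} (\<lambda>i. {\<mu> (Suc i)..\<mu> i}). (\<Prod>i<n. x ^ (\<mu> i - f i)) *
      Determinant.det (mat n n (\<lambda>(i, j). hom_sym xs (int (f i) - int i + int j))))"
    unfolding D_def by (rule det_mat_row_sums) simp
  also have "\<dots> = (\<Sum>\<nu> | interlaces \<nu> \<mu>. (\<Prod>i<n. x ^ (\<mu> i - \<nu> i)) *
      Determinant.det (mat n n (\<lambda>(i, j). hom_sym xs (int (\<nu> i) - int i + int j))))"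
    unfolding interlaces_below_eq[OF assms(2), symmetric]
    by (rule sum_PiE_rows, intro arg_cong2[of _ _ _ _ "(*)"] arg_cong[of _ _ Determinant.det] prod.cong eq_matI) auto
  also have "\<dots> = (\<Sum>\<nu> | interlaces \<nu> \<mu>. x ^ (weight \<mu> - weight \<nu>) * Determinant.det (jacobi_trudi n xs \<nu>))"
    by (simp add: jacobi_trudi_def prod_power_interlaces[OF _ assms(2)])
  finally show ?thesis by (simp only: A_def)
qed

text \<open>
  Both sides satisfy the same branching rule. Any \<open>n\<close> that bounds the number of rows will do, so that
  zero parts may be appended freely.
\<close>

theorem det_jacobi_trudi:
  "antimono \<mu> \<Longrightarrow> has_rows n \<mu> \<Longrightarrow> Determinant.det (jacobi_trudi n xs \<mu>) = branch_schur xs \<mu>"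
proof (induction xs arbitrary: \<mu>)
  case Nil
  show ?case
  proof (cases "\<mu> = (\<lambda>_. 0)")
    case True
    then have "jacobi_trudi n ([] :: 'a list) \<mu> = 1\<^sub>m n"
      by (auto simp: jacobi_trudi_def intro!: eq_matI)
    with True show ?thesis by simp
  next
    case False
    with Nil have "\<mu> 0 > 0" "n > 0"
      using antimono_rows_iff[of \<mu> 0] by (auto simp: has_rows_def fun_eq_iff intro: Suc_leI)
    then have "(\<Prod>i = 0..<n. jacobi_trudi n ([] :: 'a list) \<mu> $$ (i, p i)) = 0"
      if "p permutes {0..<n}" for p
      using permutes_in_image[OF that, of 0]
      by (intro prod_zero[OF _ bexI[of _ 0]]) (auto simp: jacobi_trudi_def)
    then have "Determinant.det (jacobi_trudi n ([] :: 'a list) \<mu>) = 0"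
      by (simp add: Determinant.det_def jacobi_trudi_def)
    with False show ?thesis by simp
  qed
next
  case (Cons x xs)
  then show ?case
    by (simp add: det_jacobi_trudi_Cons interlaces_antimono interlaces_rows)
qed

text \<open>
  The function that corresponds to a partition given by the list of its positive parts.
\<close>

definition pad :: "nat list \<Rightarrow> nat \<Rightarrow> nat" where
  "pad l i = (if i < length l then l ! i else 0)"

lemma antimono_pad: "is_partition l \<Longrightarrow> antimono (pad l)"
  unfolding antimono_iff_le_Suc is_partition_def
  by (auto simp: pad_def sorted_wrt_iff_nth_less)

lemma schur_eq_branch_schur:
  assumes "is_partition l"
  shows "schur N x l = branch_schur (map x [1..<N + 1]) (pad l)"
proof -
  have "schur N x l = Determinant.det (jacobi_trudi (length l) (map x [1..<N + 1]) (pad l))"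
    unfolding schur_def jacobi_trudi_def
    by (rule arg_cong[of _ _ Determinant.det], rule eq_matI) (simp_all only: complete_sym_eq_hom_sym index_mat case_prod_conv pad_def dim_row_mat dim_col_mat if_True)
  also have "\<dots> = branch_schur (map x [1..<N + 1]) (pad l)"
    by (rule det_jacobi_trudi[OF antimono_pad[OF assms]]) (simp add: has_rows_def pad_def)
  finally show ?thesis .
qed

text \<open>
  A weakly decreasing function is recovered from its values before the first zero.
\<close>

lemma bij_betw_pad:
  "bij_betw pad {l. is_partition l \<and> length l \<le> N} {\<mu>. antimono \<mu> \<and> has_rows N \<mu>}"
  unfolding bij_betw_def
proof
  show "inj_on pad {l. is_partition l \<and> length l \<le> N}"
  proof (rule inj_onI)
    fix l l' assume "l \<in> {l. is_partition l \<and> length l \<le> N}" "l' \<in> {l. is_partition l \<and> length l \<le> N}"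
      and eq: "pad l = pad l'"
    then have l: "is_partition l" "is_partition l'" by auto
    have pos: "0 < pad k i \<longleftrightarrow> i < length k" if "is_partition k" for k i
      using that by (auto simp: pad_def is_partition_def)
    have "i < length l \<longleftrightarrow> i < length l'" for i
      using pos[OF l(1), of i] pos[OF l(2), of i] by (simp add: eq)
    then have "{..<length l} = {..<length l'}" by (simp add: lessThan_def)
    then have len: "length l = length l'" by simp
    then show "l = l'"
    proof (rule nth_equalityI)
      fix i assume "i < length l"
      moreover have "pad l i = pad l' i" by (simp only: eq)
      ultimately show "l ! i = l' ! i" using len by (simp add: pad_def)
    qed
  qed
  show "pad ` {l. is_partition l \<and> length l \<le> N} = {\<mu>. antimono \<mu> \<and> has_rows N \<mu>}"
  proof (rule antisym; rule subsetI)
    fix \<mu> assume "\<mu> \<in> pad ` {l. is_partition l \<and> length l \<le> N}"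
    then show "\<mu> \<in> {\<mu>. antimono \<mu> \<and> has_rows N \<mu>}"
      by (auto simp: has_rows_def pad_def[of _ "_ :: nat"] intro: antimono_pad)
  next
    fix \<mu> :: "nat \<Rightarrow> nat" assume \<mu>: "\<mu> \<in> {\<mu>. antimono \<mu> \<and> has_rows N \<mu>}"
    \<comment> \<open>The number of positive parts.\<close>
    define n where "n = (LEAST n. \<mu> n = 0)"
    have N: "\<mu> N = 0" using \<mu> by (simp add: has_rows_def)
    have n: "\<mu> n = 0" "n \<le> N"
      unfolding n_def using N by (rule LeastI, rule Least_le)
    have "\<mu> i \<noteq> 0" if "i < n" for i
      using not_less_Least[OF that[unfolded n_def]] .
    then have "is_partition (map \<mu> [0..<n])"
      unfolding is_partition_def sorted_wrt_iff_nth_less using antimonoD[of \<mu>] \<mu> by auto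
    moreover have "pad (map \<mu> [0..<n]) = \<mu>"
    proof
      fix i
      have "\<mu> i \<le> 0" if "n \<le> i"
        using antimonoD[of \<mu> n i] \<mu> n(1) that by simp
      then show "pad (map \<mu> [0..<n]) i = \<mu> i" by (simp add: pad_def)
    qed
    ultimately show "\<mu> \<in> pad ` {l. is_partition l \<and> length l \<le> N}"
      using n by (intro image_eqI[of _ _ "map \<mu> [0..<n]"]) auto
  qed
qed

lemma bij_betw_pad_box:
  "bij_betw pad {l. is_partition l \<and> length l \<le> N \<and> (\<forall>p\<in>set l. p \<le> M)} (box N M)"
proof -
  have "(\<forall>p\<in>set l. p \<le> M) \<longleftrightarrow> pad l 0 \<le> M" if "is_partition l" for l
  proof
    assume "\<forall>p\<in>set l. p \<le> M"
    then show "pad l 0 \<le> M" by (auto simp: pad_def)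
  next
    assume M: "pad l 0 \<le> M"
    show "\<forall>p\<in>set l. p \<le> M"
    proof
      fix p assume "p \<in> set l"
      then obtain i where "i < length l" "p = l ! i" by (auto simp: in_set_conv_nth)
      then have "p = pad l i" by (simp add: pad_def)
      also have "\<dots> \<le> pad l 0" using antimonoD[OF antimono_pad[OF that], of 0 i] by simp
      finally show "p \<le> M" using M by simp
    qed
  qed
  then have "bij_betw pad {l \<in> {l. is_partition l \<and> length l \<le> N}. \<forall>p\<in>set l. p \<le> M}
      {\<mu> \<in> {\<mu>. antimono \<mu> \<and> has_rows N \<mu>}. \<mu> 0 \<le> M}"
    by (intro bij_betw_Collect[OF bij_betw_pad]) auto
  then show ?thesis by (simp add: box_def conj_assoc)
qed

section \<open>The Pieri rule\<close>

text \<open>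
  Given \<open>\<alpha>\<close> and \<open>\<beta>\<close>, a partition \<open>\<mu>\<close> obtained from both by adding a strip has \<open>\<mu>\<^sub>i\<^sub>+\<^sub>1\<close> between
  \<open>max \<alpha>\<^sub>i\<^sub>+\<^sub>1 \<beta>\<^sub>i\<^sub>+\<^sub>1\<close> and \<open>min \<alpha>\<^sub>i \<beta>\<^sub>i\<close>, and a partition \<open>\<kappa>\<close> obtained from both by removing a strip has \<open>\<kappa>\<^sub>i\<close> in
  the same interval. Reflecting this interval exchanges the two.
\<close>

lemma interlaces_switch:
  assumes "\<And>i. \<mu> (Suc i) + \<kappa> i = min (\<alpha> i) (\<beta> i) + max (\<alpha> (Suc i)) (\<beta> (Suc i))"
    and "max (\<alpha> 0) (\<beta> 0) \<le> \<mu> 0"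
  shows "interlaces \<alpha> \<mu> \<and> interlaces \<beta> \<mu> \<longleftrightarrow> interlaces \<kappa> \<alpha> \<and> interlaces \<kappa> \<beta>"
proof
  assume l: "interlaces \<alpha> \<mu> \<and> interlaces \<beta> \<mu>"
  show "interlaces \<kappa> \<alpha> \<and> interlaces \<kappa> \<beta>"
    unfolding interlaces_def all_conj_distrib[symmetric]
  proof
    fix i
    have "\<mu> (Suc i) \<le> min (\<alpha> i) (\<beta> i)" "max (\<alpha> (Suc i)) (\<beta> (Suc i)) \<le> \<mu> (Suc i)"
      using l by (auto simp: interlaces_def)
    with assms(1)[of i]
    show "(\<alpha> (Suc i) \<le> \<kappa> i \<and> \<kappa> i \<le> \<alpha> i) \<and> \<beta> (Suc i) \<le> \<kappa> i \<and> \<kappa> i \<le> \<beta> i"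
      by linarith
  qed
next
  assume r: "interlaces \<kappa> \<alpha> \<and> interlaces \<kappa> \<beta>"
  have *: "\<mu> (Suc i) \<le> \<alpha> i \<and> \<mu> (Suc i) \<le> \<beta> i \<and> \<alpha> (Suc i) \<le> \<mu> (Suc i) \<and> \<beta> (Suc i) \<le> \<mu> (Suc i)" for i
  proof -
    have "\<kappa> i \<le> min (\<alpha> i) (\<beta> i)" "max (\<alpha> (Suc i)) (\<beta> (Suc i)) \<le> \<kappa> i"
      using r by (auto simp: interlaces_def)
    with assms(1)[of i] show ?thesis by linarith
  qed
  moreover have "\<alpha> i \<le> \<mu> i \<and> \<beta> i \<le> \<mu> i" for i
    using assms(2) * by (cases i) auto
  ultimately show "interlaces \<alpha> \<mu> \<and> interlaces \<beta> \<mu>"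
    by (simp add: interlaces_def)
qed

text \<open>
  The reflection leaves only the first part of \<open>\<mu>\<close> free, and its excess \<open>k\<close> over the least possible
  value accounts for the difference of the weights. Summing \<open>min + max = \<alpha>\<^sub>i + \<beta>\<^sub>i\<close> over the rows gives
  the formula.
\<close>

lemma weight_switch:
  assumes sw: "\<And>i. \<mu> (Suc i) + \<kappa> i = min (\<alpha> i) (\<beta> i) + max (\<alpha> (Suc i)) (\<beta> (Suc i))"
    and top: "\<mu> 0 = max (\<alpha> 0) (\<beta> 0) + k"
    and rows: "has_rows n \<alpha>" "has_rows n \<beta>" "has_rows n \<kappa>" "has_rows (Suc n) \<mu>"
  shows "weight \<mu> + weight \<kappa> = k + weight \<alpha> + weight \<beta>"
proof -
  have "weight \<mu> + weight \<kappa> = \<mu> 0 + (\<Sum>i<n. \<mu> (Suc i) + \<kappa> i)"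
    using rows by (simp add: weight_eq[of n \<kappa>] weight_eq[of "Suc n"] sum.lessThan_Suc_shift sum.distrib del: sum.lessThan_Suc)
  also have "\<dots> = k + (\<Sum>i<n. min (\<alpha> i) (\<beta> i)) + (\<Sum>i<Suc n. max (\<alpha> i) (\<beta> i))"
    by (simp add: sw top sum.lessThan_Suc_shift sum.distrib del: sum.lessThan_Suc)
  also have "(\<Sum>i<Suc n. max (\<alpha> i) (\<beta> i)) = (\<Sum>i<n. max (\<alpha> i) (\<beta> i))"
    using rows by (simp add: has_rows_def)
  also have "k + (\<Sum>i<n. min (\<alpha> i) (\<beta> i)) + (\<Sum>i<n. max (\<alpha> i) (\<beta> i)) = k + (\<Sum>i<n. \<alpha> i + \<beta> i)"
    by (simp add: sum.distrib[symmetric] min_add_distrib_left del: sum.distrib)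
      (rule sum.cong; simp add: min_def max_def)
  also have "\<dots> = k + weight \<alpha> + weight \<beta>"
    using rows by (simp add: weight_eq[of n] sum.distrib)
  finally show ?thesis .
qed

text \<open>
  For the induction step, expand \<open>S\<^sub>\<mu>(x # xs)\<close> by removing a strip that leads from \<open>\<mu>\<close> to \<open>\<alpha>\<close>. For
  fixed \<open>\<alpha>\<close> the reflection above replaces \<open>\<mu>\<close> by a number \<open>k\<close> and a partition \<open>\<kappa>\<close> below \<open>\<alpha>\<close> and \<open>\<nu>\<close>. The sum over
  \<open>\<alpha>\<close> then falls under the induction hypothesis for \<open>\<kappa>\<close>, the sum over \<open>\<kappa>\<close> is the branching of
  \<open>S\<^sub>\<nu>\<close>, and the sum over \<open>k\<close> is the expansion of \<open>h\<^sub>r(x # xs)\<close> in powers of \<open>x\<close>.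
\<close>

theorem pieri:
  "has_rows n \<nu> \<Longrightarrow> (\<Sum>\<mu> | interlaces \<nu> \<mu> \<and> weight \<mu> = weight \<nu> + r. branch_schur xs \<mu>)
    = hom_sym xs (int r) * branch_schur xs \<nu>"
proof (induction xs arbitrary: \<nu> n r)
  case Nil
  let ?A = "{\<mu>. interlaces \<nu> \<mu> \<and> weight \<mu> = weight \<nu> + r}"
  have nu0: "interlaces \<nu> (\<lambda>_. 0) \<longleftrightarrow> \<nu> = (\<lambda>_. 0)"
    by (auto simp: interlaces_def fun_eq_iff)
  have w0: "weight (\<lambda>_. 0) = 0" by (simp add: weight_eq[of 0] has_rows_def)
  have "(\<Sum>\<mu>\<in>?A. branch_schur [] \<mu>) = (\<Sum>\<mu>\<in>?A. if \<mu> = (\<lambda>_. 0) then 1 else 0 :: 'a)"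
    by simp
  also have "\<dots> = (if (\<lambda>_. 0) \<in> ?A then 1 else 0)"
    by (rule sum.delta[OF finite_interlaces_above[OF Nil]])
  also have "(\<lambda>_. 0) \<in> ?A \<longleftrightarrow> r = 0 \<and> \<nu> = (\<lambda>_. 0)"
    using w0 by (auto simp: nu0)
  finally show ?case by simp
next
  case (Cons x xs)
  let ?below = "\<lambda>\<mu>. {\<alpha>. interlaces \<alpha> \<mu>}"
  let ?above = "\<lambda>\<nu> r. {\<mu>. interlaces \<nu> \<mu> \<and> weight \<mu> = weight \<nu> + r}"
  \<comment> \<open>The sum of the two end points of the interval in which \<open>\<mu>\<^sub>i\<^sub>+\<^sub>1\<close> and \<open>\<kappa>\<^sub>i\<close> vary.\<close>
  let ?m = "\<lambda>\<alpha> i. min (\<alpha> i) (\<nu> i) + max (\<alpha> (Suc i)) (\<nu> (Suc i))"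
  let ?up = "\<lambda>((k, \<kappa>), \<alpha>). (\<lambda>i. case i of 0 \<Rightarrow> max (\<alpha> 0) (\<nu> 0) + k | Suc j \<Rightarrow> ?m \<alpha> j - \<kappa> j, \<alpha>)"
  let ?down = "\<lambda>(\<mu>, \<alpha>). ((\<mu> 0 - max (\<alpha> 0) (\<nu> 0), \<lambda>i. ?m \<alpha> i - \<mu> (Suc i)), \<alpha>)"
  let ?L = "SIGMA \<mu>:?above \<nu> r. ?below \<mu>"
  let ?R = "SIGMA z:{..r} \<times> ?below \<nu>. ?above (snd z) (r - fst z)"
  have IH: "sum (branch_schur xs) (?above \<kappa> (r - k)) = hom_sym xs (int r - int k) * branch_schur xs \<kappa>"
    if "interlaces \<kappa> \<nu>" "k \<le> r" for \<kappa> k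
    using Cons.IH[OF interlaces_rows(1)[OF that(1) Cons.prems], of "r - k"] that(2)
    by (simp only: of_nat_diff)
  have rowsS: "has_rows (Suc n) \<nu>" using Cons.prems by (rule rows_mono) simp
  have main: "weight \<mu> + weight \<kappa> = k + weight \<alpha> + weight \<nu> \<and> weight \<kappa> \<le> weight \<alpha> \<and> weight \<kappa> \<le> weight \<nu> \<and> weight \<alpha> \<le> weight \<mu> \<and>
      interlaces \<alpha> \<mu> \<and> interlaces \<nu> \<mu> \<and> interlaces \<kappa> \<alpha> \<and> interlaces \<kappa> \<nu>"
    if sw: "\<And>i. \<mu> (Suc i) + \<kappa> i = ?m \<alpha> i" and top: "\<mu> 0 = max (\<alpha> 0) (\<nu> 0) + k"
    and or: "interlaces \<alpha> \<mu> \<and> interlaces \<nu> \<mu> \<or> interlaces \<kappa> \<alpha> \<and> interlaces \<kappa> \<nu>"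
  for \<mu> \<alpha> \<kappa> k
  proof -
    have il: "interlaces \<alpha> \<mu> \<and> interlaces \<nu> \<mu> \<and> interlaces \<kappa> \<alpha> \<and> interlaces \<kappa> \<nu>"
      using interlaces_switch[of \<mu> \<kappa> \<alpha> \<nu>, OF sw] top or by auto
    then have rows: "has_rows n \<kappa>" "has_rows (Suc n) \<mu>" "has_rows (Suc n) \<alpha>"
      using interlaces_rows Cons.prems by blast+
    then have "has_rows (Suc n) \<kappa>" "has_rows (Suc (Suc n)) \<mu>"
      by (simp_all add: has_rows_def)
    with rows rowsS il show ?thesis
      using weight_switch[of \<mu> \<kappa> \<alpha> \<nu> k "Suc n", OF sw top] interlaces_weight by blast
  qed
  have "(\<Sum>\<mu>\<in>?above \<nu> r. branch_schur (x # xs) \<mu>)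
      = (\<Sum>(\<mu>, \<alpha>)\<in>?L. x ^ (weight \<mu> - weight \<alpha>) * branch_schur xs \<alpha>)"
    unfolding branch_schur.simps
    by (rule sum.Sigma[OF finite_interlaces_above[OF Cons.prems]])
      (use finite_interlaces_below interlaces_rows(2)[OF _ Cons.prems] in blast)
  also have "\<dots> = (\<Sum>((k, \<kappa>), \<alpha>)\<in>?R. x ^ k * x ^ (weight \<nu> - weight \<kappa>) * branch_schur xs \<alpha>)"
  proof (rule sum.reindex_bij_witness[of _ ?up ?down])
    fix z assume z: "z \<in> ?L"
    obtain \<mu> \<alpha> where [simp]: "z = (\<mu>, \<alpha>)" by force
    define k where "k = \<mu> 0 - max (\<alpha> 0) (\<nu> 0)"
    define \<kappa> where "\<kappa> = (\<lambda>i. ?m \<alpha> i - \<mu> (Suc i))"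
    from z have il: "interlaces \<alpha> \<mu>" "interlaces \<nu> \<mu>" and w: "weight \<mu> = weight \<nu> + r" by auto
    have le: "\<mu> (Suc i) \<le> ?m \<alpha> i" for i
      using il by (simp add: interlaces_def min_def trans_le_add1)
    then have sw: "\<mu> (Suc i) + \<kappa> i = ?m \<alpha> i" for i
      by (simp add: \<kappa>_def)
    have top: "\<mu> 0 = max (\<alpha> 0) (\<nu> 0) + k"
      using il by (simp add: interlaces_def k_def)
    have m: "weight \<mu> + weight \<kappa> = k + weight \<alpha> + weight \<nu>" "weight \<kappa> \<le> weight \<alpha>" "weight \<kappa> \<le> weight \<nu>"
      "weight \<alpha> \<le> weight \<mu>" "interlaces \<kappa> \<alpha>" "interlaces \<kappa> \<nu>"
      using main[OF sw top] il by blast+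
    have d: "?down z = ((k, \<kappa>), \<alpha>)" by (simp add: k_def \<kappa>_def)
    show "?up (?down z) = z"
      unfolding d using sw top by (auto simp: fun_eq_iff \<kappa>_def le split: nat.split)
    show "?down z \<in> ?R"
      unfolding d using m w by auto
    have "weight \<mu> - weight \<alpha> = k + (weight \<nu> - weight \<kappa>)" using m by linarith
    then show "(\<lambda>((k, \<kappa>), \<alpha>). x ^ k * x ^ (weight \<nu> - weight \<kappa>) * branch_schur xs \<alpha>) (?down z)
        = (case z of (\<mu>, \<alpha>) \<Rightarrow> x ^ (weight \<mu> - weight \<alpha>) * branch_schur xs \<alpha>)"
      unfolding d by (simp add: power_add)
  next
    fix z assume z: "z \<in> ?R"
    obtain k \<kappa> \<alpha> where [simp]: "z = ((k, \<kappa>), \<alpha>)" by (metis surj_pair)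
    define \<mu> where "\<mu> = (\<lambda>i. case i of 0 \<Rightarrow> max (\<alpha> 0) (\<nu> 0) + k | Suc j \<Rightarrow> ?m \<alpha> j - \<kappa> j)"
    from z have il: "interlaces \<kappa> \<alpha>" "interlaces \<kappa> \<nu>" and k: "k \<le> r"
      and w: "weight \<alpha> = weight \<kappa> + (r - k)" by auto
    have le: "\<kappa> i \<le> ?m \<alpha> i" for i
      using il by (simp add: interlaces_def min_def trans_le_add1)
    then have sw: "\<mu> (Suc i) + \<kappa> i = ?m \<alpha> i" for i
      by (simp add: \<mu>_def)
    have top: "\<mu> 0 = max (\<alpha> 0) (\<nu> 0) + k"
      by (simp add: \<mu>_def)
    have m: "weight \<mu> + weight \<kappa> = k + weight \<alpha> + weight \<nu>" "interlaces \<alpha> \<mu>" "interlaces \<nu> \<mu>"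
      using main[OF sw top] il by blast+
    have d: "?up z = (\<mu>, \<alpha>)" by (simp add: \<mu>_def)
    show "?down (?up z) = z"
      unfolding d using le by (auto simp: fun_eq_iff \<mu>_def)
    show "?up z \<in> ?L"
      unfolding d using m w k by auto
  qed
  also have "\<dots> = (\<Sum>(k, \<kappa>)\<in>{..r} \<times> ?below \<nu>. \<Sum>\<alpha>\<in>?above \<kappa> (r - k).
      x ^ k * x ^ (weight \<nu> - weight \<kappa>) * branch_schur xs \<alpha>)"
    using finite_interlaces_below[OF Cons.prems] finite_interlaces_above interlaces_rows(1)[OF _ Cons.prems]
    by (subst sum.Sigma[symmetric]) (auto simp: case_prod_unfold)
  also have "\<dots> = (\<Sum>(k, \<kappa>)\<in>{..r} \<times> ?below \<nu>.
      x ^ k * x ^ (weight \<nu> - weight \<kappa>) * (hom_sym xs (int r - int k) * branch_schur xs \<kappa>))"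
    by (intro sum.cong) (auto simp only: IH sum_distrib_left[symmetric] mem_Sigma_iff atMost_iff mem_Collect_eq split: prod.split)
  also have "\<dots> = hom_sym (x # xs) (int r) * branch_schur (x # xs) \<nu>"
    by (simp add: sum.cartesian_product[symmetric] sum_product mult_ac)
  finally show ?case .
qed

section \<open>The Cauchy identity, graded by the weight\<close>

definition partitions_of :: "nat \<Rightarrow> nat \<Rightarrow> (nat \<Rightarrow> nat) set" where
  "partitions_of N d = {\<mu>. antimono \<mu> \<and> has_rows N \<mu> \<and> weight \<mu> = d}"

lemma finite_partitions_of: "finite (partitions_of N d)"
  by (rule finite_subset[OF _ finite_bounded_rows[of N d]])
    (auto simp: partitions_of_def intro: weight_ge_part)

text \<open>
  The part of \<open>\<Sum>\<^sub>\<mu> S\<^sub>\<mu>(x) S\<^sub>\<mu>(y)\<close> of weight \<open>d\<close>. This grading keeps every sum finite, over any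
  commutative ring.
\<close>

definition cauchy_part :: "nat \<Rightarrow> 'a::comm_ring_1 list \<Rightarrow> 'a list \<Rightarrow> nat \<Rightarrow> 'a" where
  "cauchy_part N xs ys d = (\<Sum>\<mu>\<in>partitions_of N d. branch_schur xs \<mu> * branch_schur ys \<mu>)"

text \<open>
  Branching of \<open>S\<^sub>\<mu>(y # ys)\<close> leads from \<open>\<mu>\<close> to a smaller \<open>\<nu>\<close>; summing over \<open>\<mu>\<close> first, for fixed \<open>\<nu>\<close>, is the Pieri
  rule.
\<close>

lemma cauchy_part_Cons:
  assumes "length xs \<le> N"
  shows "cauchy_part N xs (y # ys) d = (\<Sum>r\<le>d. y ^ r * hom_sym xs (int r) * cauchy_part N xs ys (d - r))"
proof -
  let ?L = "SIGMA \<mu>:partitions_of N d. {\<nu>. interlaces \<nu> \<mu>}"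
  let ?above = "\<lambda>\<nu> r. {\<mu>. interlaces \<nu> \<mu> \<and> weight \<mu> = weight \<nu> + r}"
  let ?R = "SIGMA r:{..d}. SIGMA \<nu>:partitions_of N (d - r). ?above \<nu> r"
  \<comment> \<open>The Pieri rule produces partitions with one more row than \<open>N\<close>; these have \<open>S\<^sub>\<mu>(xs) = 0\<close>.\<close>
  let ?R' = "SIGMA r:{..d}. SIGMA \<nu>:partitions_of N (d - r). ?above \<nu> r \<inter> {\<mu>. has_rows N \<mu>}"
  have fin: "finite (?above \<nu> r)" if "\<nu> \<in> partitions_of N e" for \<nu> r e
    using that by (intro finite_interlaces_above[of N]) (auto simp: partitions_of_def)
  have "cauchy_part N xs (y # ys) d
      = (\<Sum>(\<mu>, \<nu>)\<in>?L. branch_schur xs \<mu> * (y ^ (weight \<mu> - weight \<nu>) * branch_schur ys \<nu>))"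
    unfolding cauchy_part_def branch_schur.simps sum_distrib_left
    by (rule sum.Sigma[OF finite_partitions_of])
      (auto simp: partitions_of_def intro: finite_interlaces_below)
  also have "\<dots> = (\<Sum>(r, \<nu>, \<mu>)\<in>?R'. y ^ r * branch_schur ys \<nu> * branch_schur xs \<mu>)"
  proof (rule sum.reindex_bij_witness[of _ "\<lambda>(r, \<nu>, \<mu>). (\<mu>, \<nu>)" "\<lambda>(\<mu>, \<nu>). (weight \<mu> - weight \<nu>, \<nu>, \<mu>)"])
    fix z assume "z \<in> ?L"
    then obtain \<mu> \<nu> where [simp]: "z = (\<mu>, \<nu>)" and
      *: "antimono \<mu>" "has_rows N \<mu>" "weight \<mu> = d" "interlaces \<nu> \<mu>" by (auto simp: partitions_of_def)
    have "weight \<nu> \<le> weight \<mu>" using * interlaces_weight by blast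
    then show "(case z of (\<mu>, \<nu>) \<Rightarrow> (weight \<mu> - weight \<nu>, \<nu>, \<mu>)) \<in> ?R'"
      using * interlaces_antimono interlaces_rows by (auto simp: partitions_of_def)
  next
    fix z assume "z \<in> ?R'"
    then show "(case z of (r, \<nu>, \<mu>) \<Rightarrow> (\<mu>, \<nu>)) \<in> ?L"
      using interlaces_antimono by (auto simp: partitions_of_def)
  qed (auto simp: mult_ac)
  also have "\<dots> = (\<Sum>(r, \<nu>, \<mu>)\<in>?R. y ^ r * branch_schur ys \<nu> * branch_schur xs \<mu>)"
  proof (rule sum.mono_neutral_left)
    show "finite ?R" using fin by (intro finite_SigmaI finite_partitions_of) auto
    have "has_rows N \<mu>" if "interlaces \<nu> \<mu>" "branch_schur xs \<mu> \<noteq> 0" for \<nu> \<mu>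
      using branch_schur_length[OF that(2)] antimono_rows_iff[of \<mu> "length xs"] that(1)
        interlaces_antimono(2) rows_mono[OF _ assms] by blast
    then show "\<forall>z\<in>?R - ?R'. (case z of (r, \<nu>, \<mu>) \<Rightarrow> y ^ r * branch_schur ys \<nu> * branch_schur xs \<mu>) = 0"
      by force
  qed auto
  also have "\<dots> = (\<Sum>r\<le>d. \<Sum>\<nu>\<in>partitions_of N (d - r). \<Sum>\<mu>\<in>?above \<nu> r. y ^ r * branch_schur ys \<nu> * branch_schur xs \<mu>)"
    using fin by (simp add: sum.Sigma finite_partitions_of finite_SigmaI case_prod_unfold)
  also have "\<dots> = (\<Sum>r\<le>d. \<Sum>\<nu>\<in>partitions_of N (d - r). y ^ r * branch_schur ys \<nu> * (hom_sym xs (int r) * branch_schur xs \<nu>))"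
    unfolding sum_distrib_left[symmetric]
    by (intro sum.cong arg_cong2[of _ _ _ _ "(*)"] refl pieri[of N]) (auto simp: partitions_of_def)
  also have "\<dots> = (\<Sum>r\<le>d. y ^ r * hom_sym xs (int r) * cauchy_part N xs ys (d - r))"
    by (simp add: cauchy_part_def sum_distrib_left mult_ac)
  finally show ?thesis .
qed

lemma cauchy_part_Nil: "cauchy_part N xs [] d = (if d = 0 then 1 else 0)"
proof -
  have "cauchy_part N xs [] d = (\<Sum>\<mu>\<in>partitions_of N d. if \<mu> = (\<lambda>_. 0) then 1 else 0)"
    unfolding cauchy_part_def by (rule sum.cong) (auto simp: branch_schur_zero)
  also have "\<dots> = (if (\<lambda>_. 0) \<in> partitions_of N d then 1 else 0)"
    by (rule sum.delta[OF finite_partitions_of])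
  also have "(\<lambda>_. 0) \<in> partitions_of N d \<longleftrightarrow> d = 0"
    by (auto simp: partitions_of_def weight_eq[of 0] has_rows_def antimono_def)
  finally show ?thesis .
qed

text \<open>
  The generating function of the complete symmetric polynomials: the recursion \<open>hom_sym_rec\<close> says that
  the factor \<open>1 - x y t\<close> removes the variable \<open>x\<close>.
\<close>

lemma fps_hom_sym_inverse:
  "Abs_fps (\<lambda>r. y ^ r * hom_sym xs (int r)) * (\<Prod>x\<leftarrow>xs. 1 - fps_const (x * y) * fps_X) = 1"
proof (induction xs)
  case Nil
  show ?case by (simp add: fps_eq_iff)
next
  case (Cons x xs)
  define F where "F = Abs_fps (\<lambda>r. y ^ r * hom_sym (x # xs) (int r))"
  have "F * (1 - fps_const (x * y) * fps_X) = Abs_fps (\<lambda>r. y ^ r * hom_sym xs (int r))"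
  proof (rule fps_ext)
    fix r
    have "F * (1 - fps_const (x * y) * fps_X) = F - fps_const (x * y) * (F * fps_X)"
      by (simp only: right_diff_distrib mult_1_right mult.left_commute)
    then have "fps_nth (F * (1 - fps_const (x * y) * fps_X)) r
        = fps_nth F r - x * y * (if r = 0 then 0 else fps_nth F (r - 1))"
      by simp
    also have "\<dots> = y ^ r * hom_sym xs (int r)"
      using hom_sym_rec[of x xs "int r"]
      by (cases r) (simp_all add: F_def hom_sym_neg algebra_simps del: hom_sym.simps(2))
    finally show "fps_nth (F * (1 - fps_const (x * y) * fps_X)) r
      = fps_nth (Abs_fps (\<lambda>r. y ^ r * hom_sym xs (int r))) r" by simp
  qed
  then have "F * (\<Prod>x\<leftarrow>x # xs. 1 - fps_const (x * y) * fps_X)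
      = Abs_fps (\<lambda>r. y ^ r * hom_sym xs (int r)) * (\<Prod>x\<leftarrow>xs. 1 - fps_const (x * y) * fps_X)"
    by (simp only: list.map prod_list.Cons mult.assoc[symmetric])
  with Cons show ?case by (simp only: F_def)
qed

theorem fps_cauchy_part:
  assumes "length xs \<le> N"
  shows "Abs_fps (cauchy_part N xs ys) * (\<Prod>y\<leftarrow>ys. \<Prod>x\<leftarrow>xs. 1 - fps_const (x * y) * fps_X) = 1"
proof (induction ys)
  case Nil
  show ?case by (simp add: fps_eq_iff cauchy_part_Nil)
next
  case (Cons y ys)
  have "Abs_fps (cauchy_part N xs (y # ys)) = Abs_fps (\<lambda>r. y ^ r * hom_sym xs (int r)) * Abs_fps (cauchy_part N xs ys)"
    by (simp add: fps_eq_iff cauchy_part_Cons[OF assms] fps_mult_nth atLeast0AtMost)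
  then have "Abs_fps (cauchy_part N xs (y # ys)) * (\<Prod>y\<leftarrow>y # ys. \<Prod>x\<leftarrow>xs. 1 - fps_const (x * y) * fps_X)
    = (Abs_fps (\<lambda>r. y ^ r * hom_sym xs (int r)) * (\<Prod>x\<leftarrow>xs. 1 - fps_const (x * y) * fps_X))
      * (Abs_fps (cauchy_part N xs ys) * (\<Prod>y\<leftarrow>ys. \<Prod>x\<leftarrow>xs. 1 - fps_const (x * y) * fps_X))"
    by (simp add: mult_ac)
  with Cons show ?case by (simp add: fps_hom_sym_inverse)
qed

section \<open>The hopping operators and their commutation with particle creation\<close>

lemma eventual_value_eqI:
  assumes "\<forall>\<^sub>F L in at_bot. f L = w"
  shows "eventual_value f = w"
  unfolding eventual_value_def
proof (rule the_equality, rule assms)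
  fix u assume "\<forall>\<^sub>F L in at_bot. f L = u"
  with assms have "\<forall>\<^sub>F L :: int in at_bot. u = w"
    by eventually_elim simp
  then show "u = w" by simp
qed

lemma upto_snoc: "i \<le> j + 1 \<Longrightarrow> [i..j + 1] = [i..j] @ [j + 1]"
  using upto_rec2[of i "j + 1"] by simp

locale mps_fermions = fermions scal b c vac dvac
  for scal :: "('v, 'k :: field_char_0) mps \<Rightarrow> 'e :: ab_group_add \<Rightarrow> 'e"
    and b c :: "int \<Rightarrow> 'e \<Rightarrow> 'e" and vac :: 'e and dvac :: "'e \<Rightarrow> ('v, 'k) mps"
begin

abbreviation linear_op :: "('e \<Rightarrow> 'e) \<Rightarrow> bool" where
  "linear_op \<equiv> Modules.module_hom scal scal"

lemma linear_op_iff: "linear_op f \<longleftrightarrow> (\<forall>u v. f (u + v) = f u + f v) \<and> (\<forall>a v. f (scal a v) = scal a (f v))"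
  by (simp add: module_hom_iff module_axioms)

lemma linear_op_sum_map:
  assumes "linear_op f"
  shows "f (\<Sum>i\<in>I. scal (a i) (v i)) = (\<Sum>i\<in>I. scal (a i) (f (v i)))"
  by (simp add: module_hom.sum[OF assms] module_hom.scale[OF assms])

lemmas b_simps = module_hom.add[OF linear_b] module_hom.scale[OF linear_b] module_hom.zero[OF linear_b]
  module_hom.neg[OF linear_b]
lemmas c_simps = module_hom.add[OF linear_c] module_hom.scale[OF linear_c] module_hom.zero[OF linear_c]
  module_hom.neg[OF linear_c]

text \<open>
  The anticommutation relations give only that twice the square of a mode vanishes; characteristic 0
  of the coefficient field allows cancelling the 2.
\<close>

lemma double_eq_zero:
  fixes v :: 'e
  assumes "v + v = 0"
  shows "v = 0"
proof -
  define h :: "('v, 'k) mps" where "h = const_mps (1 / 2)"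
  have "h + h = 1"
    by (rule mps_eqI) (simp add: h_def const_mps_def plus_mps_def one_mps_def)
  then have "v = scal (h + h) v" by simp
  also have "\<dots> = scal h (v + v)"
    by (simp only: scale_left_distrib scale_right_distrib)
  also have "\<dots> = 0" by (simp only: assms scale_zero_right)
  finally show ?thesis .
qed

lemma b_b_same: "b i (b i v) = 0" and c_c_same: "c i (c i v) = 0"
  using anticomm_bb anticomm_cc double_eq_zero by blast+

lemma b_b_swap: "b i (b j v) = - b j (b i v)"
  using anticomm_bb[of i j v] by (simp add: eq_neg_iff_add_eq_0)

lemma c_c_swap: "c i (c j v) = - c j (c i v)"
  using anticomm_cc[of i j v] by (simp add: eq_neg_iff_add_eq_0)

lemma b_c_swap: "i \<noteq> - j \<Longrightarrow> b i (c j v) = - c j (b i v)"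
  using anticomm_bc[of i j v] by (simp add: eq_neg_iff_add_eq_0)

lemma c_b_swap: "c (- r) (b p v) = (if p = r then v else 0) - b p (c (- r) v)"
  using anticomm_bc[of p "- r" v] by (simp add: eq_diff_eq add.commute)

text \<open>
  The operator \<open>1 + x b\<^sub>q c\<^sub>-\<^sub>r\<close> moves a particle from position \<open>r\<close> to position \<open>q\<close>. Here \<open>b p\<close> creates a particle at
  position \<open>p\<close>, and \<open>c (- p)\<close> removes it.
\<close>

definition hop :: "('v, 'k) mps \<Rightarrow> int \<Rightarrow> int \<Rightarrow> 'e \<Rightarrow> 'e" where
  "hop x q r v = v + scal x (b q (c (- r) v))"

lemma linear_hop: "linear_op (hop x q r)"
  by (simp add: linear_op_iff hop_def b_simps c_simps scale_right_distrib mult.commute ac_simps)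

text \<open>
  For \<open>q \<noteq> r\<close> the operator \<open>b\<^sub>q c\<^sub>-\<^sub>r\<close> has square zero, so its exponential series stops after the linear term.
\<close>

lemma op_exp_eq_hop:
  assumes "q \<noteq> r"
  shows "op_exp scal (\<lambda>u. scal x (b q (c (- r) u))) = hop x q r"
proof
  fix v
  let ?A = "\<lambda>u. scal x (b q (c (- r) u))"
  have AA: "?A (?A u) = 0" for u
    using assms by (simp add: b_simps c_simps c_b_swap c_c_same)
  have A: "(?A ^^ k) v = 0" if "k \<notin> {0, 1}" for k
  proof -
    from that obtain l where k: "k = Suc (Suc l)"
      by (cases k; cases "k - 1") auto
    show ?thesis by (simp only: k funpow.simps o_def AA)
  qed
  have one: "const_mps 1 = 1"
    by (rule mps_eqI) (simp add: const_mps_def one_mps_def)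
  have "op_exp scal ?A v = (\<Sum>k\<in>{0, 1}. scal (const_mps (1 / fact k)) ((?A ^^ k) v))"
    unfolding op_exp_def
  proof (rule Sum_any.expand_superset)
    have "scal (const_mps (1 / fact k)) ((?A ^^ k) v) = 0" if "k \<notin> {0, 1}" for k
      by (simp only: A[OF that] scale_zero_right)
    then show "{k. scal (const_mps (1 / fact k)) ((?A ^^ k) v) \<noteq> 0} \<subseteq> {0, 1}"
      by blast
  qed simp
  then show "op_exp scal ?A v = hop x q r v"
    by (simp add: one hop_def)
qed

text \<open>
  A hop is multiplicative on products of creation operators: it replaces \<open>b\<^sub>r\<close> by \<open>b\<^sub>r + x b\<^sub>q\<close> and fixes
  all the others.
\<close>

lemma hop_b:
  assumes "q \<noteq> r"
  shows "hop x q r (b p v) = b p (hop x q r v) + (if p = r then scal x (b q (hop x q r v)) else 0)"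
proof -
  have "b q (hop x q r v) = b q v"
    by (simp add: hop_def b_simps b_b_same)
  moreover have "b q (b p (c (- r) v)) = - b p (b q (c (- r) v))"
    by (rule b_b_swap)
  ultimately show ?thesis
    by (simp add: hop_def c_b_swap b_simps module_hom.diff[OF linear_b] scale_right_diff_distrib scale_right_distrib algebra_simps)
qed

text \<open>
  The finite products whose eventual values, as \<open>L\<close> tends to \<open>-\<infinity>\<close>, are the operators \<open>B(x)\<close> and \<open>C(x)\<close>.
\<close>

definition trunc_B :: "('v, 'k) mps \<Rightarrow> int \<Rightarrow> int \<Rightarrow> 'e \<Rightarrow> 'e" where
  "trunc_B x L M = fold (\<lambda>i. hop x (1 - i) (2 - i)) [L..M]"

definition trunc_C :: "('v, 'k) mps \<Rightarrow> int \<Rightarrow> int \<Rightarrow> 'e \<Rightarrow> 'e" where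
  "trunc_C x L M = foldr (\<lambda>i. hop x (2 - i) (1 - i)) [L..M]"

lemma linear_fold: "(\<And>i. linear_op (f i)) \<Longrightarrow> linear_op (fold f xs)"
  by (induction xs) (auto simp: linear_op_iff)

lemma linear_foldr: "(\<And>i. linear_op (f i)) \<Longrightarrow> linear_op (foldr f xs)"
  by (induction xs) (auto simp: linear_op_iff)

lemma linear_trunc: "linear_op (trunc_B x L M)" "linear_op (trunc_C x L M)"
  by (simp_all add: trunc_B_def trunc_C_def linear_fold linear_foldr linear_hop)

lemma fermion_B_eq: "fermion_B scal b c M x v = eventual_value (\<lambda>L. trunc_B x L (int M) v)"
proof -
  have "op_exp scal (\<lambda>u. scal x (b (- (i - 1)) (c (i - 2) u))) = hop x (1 - i) (2 - i)" for i
    using op_exp_eq_hop[of "1 - i" "2 - i" x] by simp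
  then show ?thesis by (simp add: fermion_B_def trunc_B_def)
qed

lemma fermion_C_eq: "fermion_C scal b c M x v = eventual_value (\<lambda>L. trunc_C x L (int M) v)"
proof -
  have "op_exp scal (\<lambda>u. scal x (b (- i + 2) (c (i - 1) u))) = hop x (2 - i) (1 - i)" for i
    using op_exp_eq_hop[of "2 - i" "1 - i" x] by (simp add: add.commute)
  then show ?thesis by (simp add: fermion_C_def trunc_C_def)
qed

text \<open>
  The factor with index \<open>i\<close> moves a particle from \<open>2 - i\<close> to \<open>1 - i\<close>, and the factors with smaller \<open>i\<close> act first.
  So a particle at \<open>p\<close> can be carried to the left by consecutive factors as far as the wall at
  \<open>1 - M\<close>; a particle beyond the wall stays.
\<close>

lemma trunc_B_b:
  assumes "L \<le> M + 1" "p \<le> 2 - L"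
  shows "trunc_B x L M (b p v) =
    (\<Sum>q\<in>{min p (1 - M)..p}. scal (x ^ nat (p - q)) (b q (trunc_B x L M v)))"
proof -
  from assms(1) have "L - 1 \<le> M" by simp
  then show ?thesis
  proof (induction rule: int_ge_induct)
    case base
    with assms(2) show ?case by (simp add: trunc_B_def min_absorb1)
  next
    case (step M)
    let ?F = "hop x (- M) (1 - M)" and ?v = "trunc_B x L M v"
    have rec: "trunc_B x L (M + 1) u = ?F (trunc_B x L M u)" for u
      using step assms(2) by (simp add: trunc_B_def upto_snoc)
    have "trunc_B x L (M + 1) (b p v) = (\<Sum>q\<in>{min p (1 - M)..p}. scal (x ^ nat (p - q)) (?F (b q ?v)))"
      unfolding rec using step assms(2) by (simp add: linear_op_sum_map[OF linear_hop])
    also have "\<dots> = (\<Sum>q\<in>{min p (1 - M)..p}. scal (x ^ nat (p - q)) (b q (?F ?v)))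
        + (\<Sum>q\<in>{min p (1 - M)..p}. if q = 1 - M then scal (x ^ nat (p - q) * x) (b (- M) (?F ?v)) else 0)"
      by (subst sum.distrib[symmetric], rule sum.cong)
        (auto simp: hop_b scale_right_distrib)
    also have "\<dots> = (\<Sum>q\<in>{min p (1 - (M + 1))..p}. scal (x ^ nat (p - q)) (b q (?F ?v)))"
    proof (cases "1 - M \<le> p")
      case True
      then have "{min p (1 - (M + 1))..p} = insert (- M) {1 - M..p}" and m: "min p (1 - M) = 1 - M" by auto
      moreover have "nat (p + M) = Suc (nat (p - (1 - M)))" using True by simp
      ultimately show ?thesis using True
        by (simp add: add.commute mult.commute del: minus_diff_eq)
    next
      case False
      then have "min p (1 - (M + 1)) = min p (1 - M)" by simp
      with False show ?thesis by (simp add: sum.neutral)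
    qed
    finally show ?case by (simp only: rec)
  qed
qed

text \<open>
  The mirror image: the factor with index \<open>i\<close> moves a particle from \<open>1 - i\<close> to \<open>2 - i\<close>, the factors with
  larger \<open>i\<close> act first, and the particle is carried to the right as far as \<open>2 - L\<close>.
\<close>

lemma trunc_C_b:
  assumes "L \<le> M + 1" "1 - M \<le> p"
  shows "trunc_C x L M (b p v) =
    (\<Sum>q\<in>{p..max p (2 - L)}. scal (x ^ nat (q - p)) (b q (trunc_C x L M v)))"
  using assms(1)
proof (induction rule: int_le_induct)
  case base
  with assms(2) show ?case by (simp add: trunc_C_def max_absorb1)
next
  case (step L)
  let ?F = "hop x (3 - L) (2 - L)" and ?v = "trunc_C x L M v"
  have rec: "trunc_C x (L - 1) M u = ?F (trunc_C x L M u)" for u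
    using step assms(2) by (simp add: trunc_C_def upto_rec1[of "L - 1"])
  have "trunc_C x (L - 1) M (b p v) = (\<Sum>q\<in>{p..max p (2 - L)}. scal (x ^ nat (q - p)) (?F (b q ?v)))"
    unfolding rec using step assms(2) by (simp add: linear_op_sum_map[OF linear_hop])
  also have "\<dots> = (\<Sum>q\<in>{p..max p (2 - L)}. scal (x ^ nat (q - p)) (b q (?F ?v)))
      + (\<Sum>q\<in>{p..max p (2 - L)}. if q = 2 - L then scal (x ^ nat (q - p) * x) (b (3 - L) (?F ?v)) else 0)"
    by (subst sum.distrib[symmetric], rule sum.cong)
      (auto simp: hop_b scale_right_distrib)
  also have "\<dots> = (\<Sum>q\<in>{p..max p (2 - (L - 1))}. scal (x ^ nat (q - p)) (b q (?F ?v)))"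
  proof (cases "p \<le> 2 - L")
    case True
    then have "{p..max p (2 - (L - 1))} = insert (3 - L) {p..2 - L}" and m: "max p (2 - L) = 2 - L" by auto
    moreover have "nat (3 - L - p) = Suc (nat (2 - L - p))" using True by simp
    ultimately show ?thesis using True
      by (simp add: add.commute mult.commute)
  next
    case False
    then have "max p (2 - (L - 1)) = max p (2 - L)" by simp
    with False show ?thesis by (simp add: sum.neutral)
  qed
  finally show ?case by (simp only: rec)
qed

text \<open>
  The Dirac sea with the positions \<open>1, \<dots>, n\<close> emptied. The infinite wedge product is thereby replaced
  by the product of \<open>n\<close> creation operators on this vector.
\<close>

primrec low_vac :: "nat \<Rightarrow> 'e" where
  "low_vac 0 = vac"
| "low_vac (Suc n) = c (- int (Suc n)) (low_vac n)"

lemma b_low_vac: "int n < m \<Longrightarrow> b m (low_vac n) = 0"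
proof (induction n)
  case 0
  then show ?case using vac_b[of "m - 1"] by simp
next
  case (Suc n)
  then show ?case by (simp add: b_c_swap c_simps)
qed

lemma c_low_vac: "m \<le> int n \<Longrightarrow> c (- m) (low_vac n) = 0"
proof (induction n)
  case 0
  then show ?case using vac_c[of "- m"] by simp
next
  case (Suc n)
  then show ?case
    using c_c_swap[of "- m" "- int (Suc n)"] 
    by (cases "m = int (Suc n)") (auto simp: c_c_same c_simps)
qed

lemma b_low_vac_Suc: "b (int n + 1) (low_vac (Suc n)) = low_vac n"
  using anticomm_bc[of "int n + 1" "- (int n + 1)" "low_vac n"] b_low_vac[of n "int n + 1"]
  by (simp add: c_simps add.commute)

text \<open>
  The position of particle \<open>i\<close>, counted from the left end of the sea, after moving \<open>m\<close> steps to the left.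
\<close>

definition slot :: "nat \<Rightarrow> nat \<Rightarrow> int" where
  "slot i m = int i + 1 - int m"

definition slater :: "nat \<Rightarrow> (nat \<Rightarrow> nat) \<Rightarrow> 'e" where
  "slater n \<mu> = foldr (\<lambda>i. b (slot i (\<mu> i))) [0..<n] (low_vac n)"

text \<open>
  Particles that have not moved may be counted with the sea, so that \<open>n\<close> can be
  adapted to the length of the truncated products.
\<close>

lemma slater_extend:
  assumes "has_rows n \<mu>" "n \<le> m"
  shows "slater m \<mu> = slater n \<mu>"
  using assms(2)
proof (induction m rule: dec_induct)
  case (step m)
  then have "\<mu> m = 0" using assms(1) by (simp add: has_rows_def)
  with step show ?case by (simp add: slater_def slot_def b_low_vac_Suc del: low_vac.simps)
qed simp

lemma slater_empty: "slater n (\<lambda>_. 0) = vac"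
  using slater_extend[of 0 "\<lambda>_. 0" n] by (simp add: has_rows_def slater_def)

text \<open>
  Each factor would move a particle either out of an emptied position or into an occupied one.
\<close>

lemma trunc_C_low_vac: "trunc_C x L M (low_vac n) = low_vac n"
proof -
  have "hop x (2 - i) (1 - i) (low_vac n) = low_vac n" for i
  proof (cases "1 - i \<le> int n")
    case True
    then show ?thesis using c_low_vac[OF True] by (simp add: hop_def b_simps)
  next
    case False
    then show ?thesis using b_low_vac[of n "2 - i"] b_c_swap[of "2 - i" "- (1 - i)"]
      by (simp add: hop_def c_simps)
  qed
  then have "foldr (\<lambda>i. hop x (2 - i) (1 - i)) xs (low_vac n) = low_vac n" for xs
    by (induction xs) auto
  then show ?thesis by (simp add: trunc_C_def)
qed

lemma trunc_B_low_vac: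
  assumes "2 - L \<le> int n"
  shows "trunc_B x L M (low_vac n) = low_vac n"
proof -
  have "hop x (1 - i) (2 - i) (low_vac n) = low_vac n" if "L \<le> i" for i
    using c_low_vac[of "2 - i" n] assms that by (simp add: hop_def b_simps)
  then have "fold (\<lambda>i. hop x (1 - i) (2 - i)) xs (low_vac n) = low_vac n" if "\<forall>i\<in>set xs. L \<le> i" for xs
    using that by (induction xs) auto
  then show ?thesis by (simp add: trunc_B_def)
qed

section \<open>Action of the operators on the partition states\<close>

lemma foldr_intertwine:
  assumes "\<And>i v. i \<in> set is \<Longrightarrow> T (f i v) = g i (T v)"
  shows "T (foldr f is v) = foldr g is (T v)"
  using assms by (induction "is") auto

definition creation :: "(int \<Rightarrow> ('v, 'k) mps) \<Rightarrow> int set \<Rightarrow> 'e \<Rightarrow> 'e" where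
  "creation a Q v = (\<Sum>q\<in>Q. scal (a q) (b q v))"

lemma linear_creation: "linear_op (creation a Q)"
  by (simp add: linear_op_iff creation_def b_simps scale_right_distrib sum.distrib scale_sum_right mult.commute)

text \<open>
  Linear combinations of creation operators anticommute with each other, and hence with themselves.
\<close>

lemma creation_square: "creation a Q (creation a Q v) = 0"
proof (rule double_eq_zero)
  have *: "creation a Q (creation a Q v) = (\<Sum>p\<in>Q. \<Sum>q\<in>Q. scal (a p * a q) (b p (b q v)))"
    by (simp add: creation_def module_hom.sum[OF linear_b] b_simps scale_sum_right)
  have "creation a Q (creation a Q v) + creation a Q (creation a Q v)
      = (\<Sum>p\<in>Q. \<Sum>q\<in>Q. scal (a p * a q) (b p (b q v))) + (\<Sum>p\<in>Q. \<Sum>q\<in>Q. scal (a q * a p) (b q (b p v)))"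
    by (subst (2) sum.swap) (simp only: *)
  also have "\<dots> = (\<Sum>p\<in>Q. \<Sum>q\<in>Q. scal (a p * a q) (b p (b q v) + b q (b p v)))"
    by (simp add: sum.distrib[symmetric] scale_right_distrib mult.commute)
  also have "\<dots> = 0" by (simp add: anticomm_bb)
  finally show "creation a Q (creation a Q v) + creation a Q (creation a Q v) = 0" .
qed

lemma creation_split:
  assumes "\<And>q. q \<in> Q \<Longrightarrow> a q = t * a' q" "Q \<inter> R = {}" "finite Q" "finite R"
  shows "creation a (Q \<union> R) v = creation a R v + scal t (creation a' Q v)"
  using assms by (simp add: creation_def sum.union_disjoint scale_sum_right add.commute)

text \<open>
  Particle \<open>n\<close> may move anywhere between the wall \<open>m\<close> and its position \<open>p\<^sub>n\<close>. The part of this sum at or to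
  the left of \<open>p\<^sub>n\<^sub>-\<^sub>1\<close> is a multiple of the sum for particle \<open>n - 1\<close>, which stands just before
  it in the product and annihilates it. Working from the right end of the product, every sum is
  cut off at the old position of its left neighbour.
\<close>

lemma foldr_creation_left:
  assumes p: "\<And>i. p i < p (Suc i)" and m: "m \<le> p 0"
  shows "foldr (\<lambda>i. creation (\<lambda>q. x ^ nat (p i - q)) {m..p i}) [0..<n] v =
    foldr (\<lambda>i. creation (\<lambda>q. x ^ nat (p i - q)) {(case i of 0 \<Rightarrow> m | Suc j \<Rightarrow> p j + 1)..p i}) [0..<n] v"
    (is "foldr ?S _ _ = foldr ?D _ _")
proof (induction n arbitrary: v)
  case (Suc n)
  show ?case
  proof (cases n)
    case (Suc k)
    have "m \<le> p k" by (induction k) (use m p in \<open>auto intro: less_imp_le le_less_trans\<close>)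
    then have un: "{m..p n} = {m..p k} \<union> {p k + 1..p n}" using p[of k] Suc by auto
    have S: "?S n v = ?D n v + scal (x ^ nat (p n - p k)) (?S k v)"
      unfolding un using p[of k] Suc
      by (subst creation_split[where a' = "\<lambda>q. x ^ nat (p k - q)" and t = "x ^ nat (p n - p k)"])
        (auto simp: power_add[symmetric] nat_add_distrib[symmetric])
    have lin: "linear_op (foldr ?S [0..<n])" by (rule linear_foldr) (rule linear_creation)
    \<comment> \<open>Particle \<open>k\<close> is the left neighbour of particle \<open>n\<close>, so its sum meets itself.\<close>
    have "foldr ?S [0..<n] (?S k v) = foldr ?S [0..<k] (?S k (?S k v))"
      by (simp add: Suc)
    also have "\<dots> = 0"
      by (simp add: creation_square module_hom.zero[OF linear_foldr] linear_creation)
    finally have "foldr ?S [0..<n] (?S n v) = foldr ?S [0..<n] (?D n v)"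
      unfolding S by (simp add: module_hom.add[OF lin] module_hom.scale[OF lin])
    with Suc.IH show ?thesis by simp
  qed simp
qed simp

text \<open>
  The same cancellation for moves to the right; here the part beyond the right neighbour is
  removed, working from the left end of the product.
\<close>

lemma foldr_creation_right:
  assumes p: "\<And>i. p i < p (Suc i)" and "k \<le> n"
  shows "foldr (\<lambda>i. creation (\<lambda>q. x ^ nat (q - p i)) {p i..p n - 1}) [k..<n] v =
    foldr (\<lambda>i. creation (\<lambda>q. x ^ nat (q - p i)) {p i..p (Suc i) - 1}) [k..<n] v"
    (is "foldr ?T _ _ = foldr ?D _ _")
  using assms(2)
proof (induction k rule: inc_induct)
  case (step k)
  have "?T k (foldr ?T [Suc k..<n] v) = ?D k (foldr ?T [Suc k..<n] v)"
  proof (cases "Suc k = n")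
    case False
    with step have n: "Suc k < n" by simp
    define w where "w = foldr ?T [Suc (Suc k)..<n] v"
    have w: "foldr ?T [Suc k..<n] v = ?T (Suc k) w"
      using n by (simp add: w_def upt_conv_Cons)
    have "p (Suc k) \<le> p n - 1"
      using lift_Suc_mono_less[of p, OF p n] by simp
    then have un: "{p k..p n - 1} = {p (Suc k)..p n - 1} \<union> {p k..p (Suc k) - 1}"
      using p[of k] by auto
    have "?T k u = ?D k u + scal (x ^ nat (p (Suc k) - p k)) (?T (Suc k) u)" for u
      unfolding un using p[of k]
      by (subst creation_split[where a' = "\<lambda>q. x ^ nat (q - p (Suc k))" and t = "x ^ nat (p (Suc k) - p k)"])
        (auto simp: power_add[symmetric] nat_add_distrib[symmetric])
    then show ?thesis by (simp add: w creation_square)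
  qed simp
  with step show ?case by (simp add: upt_conv_Cons)
qed simp

lemma foldr_sums:
  assumes "\<And>i. i < n \<Longrightarrow> finite (S i)"
  shows "foldr (\<lambda>i v. \<Sum>m\<in>S i. scal (a i m) (b (slot i m) v)) [0..<n] v =
    (\<Sum>f\<in>PiE {..<n} S. scal (\<Prod>i<n. a i (f i)) (foldr (\<lambda>i. b (slot i (f i))) [0..<n] v))"
  using assms
proof (induction n arbitrary: v)
  case (Suc n)
  have upd: "foldr (\<lambda>i. b (slot i (if i = n then m else f i))) [0..<n] v = foldr (\<lambda>i. b (slot i (f i))) [0..<n] v" for f m v
    by (rule foldr_cong) auto
  have lin: "linear_op (foldr (\<lambda>i. b (slot i (f i))) [0..<n])" for f
    by (rule linear_foldr) (rule linear_b)
  let ?u = "\<Sum>m\<in>S n. scal (a n m) (b (slot n m) v)"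
  let ?t = "\<lambda>f. scal (\<Prod>i<Suc n. a i (f i)) (foldr (\<lambda>i. b (slot i (f i))) [0..<Suc n] v)"
  have "foldr (\<lambda>i v. \<Sum>m\<in>S i. scal (a i m) (b (slot i m) v)) [0..<Suc n] v =
    (\<Sum>f\<in>PiE {..<n} S. scal (\<Prod>i<n. a i (f i)) (foldr (\<lambda>i. b (slot i (f i))) [0..<n] ?u))"
    using Suc by simp
  also have "\<dots> = (\<Sum>f\<in>PiE {..<n} S. \<Sum>m\<in>S n. ?t (f(n := m)))"
    by (simp add: linear_op_sum_map[OF lin] scale_sum_right upd)
  also have "\<dots> = (\<Sum>(m, f)\<in>S n \<times> PiE {..<n} S. ?t (f(n := m)))"
    by (subst sum.swap) (rule sum.cartesian_product)
  also have "\<dots> = (\<Sum>f\<in>PiE (insert n {..<n}) S. ?t f)"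
    unfolding PiE_insert_eq
    by (subst sum.reindex[OF inj_combinator]) (simp_all only: lessThan_iff less_irrefl case_prod_unfold o_def not_False_eq_True)
  finally show ?case by (simp only: lessThan_Suc)
qed simp

lemma slot_less: "antimono \<mu> \<Longrightarrow> slot i (\<mu> i) < slot (Suc i) (\<mu> (Suc i))"
  using antimonoD[of \<mu> i "Suc i"] by (simp add: slot_def)

lemma creation_slots:
  "creation a {slot i h..slot i l} = (\<lambda>v. \<Sum>m\<in>{l..h}. scal (a (slot i m)) (b (slot i m) v))"
  unfolding creation_def
  by (intro ext sum.reindex_bij_witness[of _ "slot i" "\<lambda>q. nat (int i + 1 - q)"]) (auto simp: slot_def)

lemma foldr_sums_slater:
  assumes "\<And>i. i < n \<Longrightarrow> finite (S i)"
  shows "foldr (\<lambda>i v. \<Sum>m\<in>S i. scal (a i m) (b (slot i m) v)) [0..<n] (low_vac n) =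
    (\<Sum>\<nu> | has_rows n \<nu> \<and> (\<forall>i<n. \<nu> i \<in> S i). scal (\<Prod>i<n. a i (\<nu> i)) (slater n \<nu>))"
proof -
  have "foldr (\<lambda>i v. \<Sum>m\<in>S i. scal (a i m) (b (slot i m) v)) [0..<n] (low_vac n) =
    (\<Sum>f\<in>PiE {..<n} S. scal (\<Prod>i<n. a i (f i)) (foldr (\<lambda>i. b (slot i (f i))) [0..<n] (low_vac n)))"
    by (rule foldr_sums) (rule assms)
  also have "\<dots> = (\<Sum>\<nu> | has_rows n \<nu> \<and> (\<forall>i<n. \<nu> i \<in> S i).
      scal (\<Prod>i<n. a i (\<nu> i)) (foldr (\<lambda>i. b (slot i (\<nu> i))) [0..<n] (low_vac n)))"
  proof (rule sum_PiE_rows)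
    fix f g :: "nat \<Rightarrow> nat" assume eq: "\<And>i. i < n \<Longrightarrow> f i = g i"
    have "foldr (\<lambda>i. b (slot i (f i))) [0..<n] v = foldr (\<lambda>i. b (slot i (g i))) [0..<n] v" for v
      by (rule foldr_cong) (auto simp: eq)
    moreover have "(\<Prod>i<n. a i (f i)) = (\<Prod>i<n. a i (g i))"
      by (rule prod.cong) (simp_all add: eq)
    ultimately show "scal (\<Prod>i<n. a i (f i)) (foldr (\<lambda>i. b (slot i (f i))) [0..<n] (low_vac n))
      = scal (\<Prod>i<n. a i (g i)) (foldr (\<lambda>i. b (slot i (g i))) [0..<n] (low_vac n))"
      by (simp only:)
  qed
  finally show ?thesis by (simp only: slater_def)
qed

text \<open>
  The number of particles is chosen such that \<open>2 - L = n\<close>: then every factor that acts on the emptied sea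
  would have to remove a particle from an empty position, while all \<open>n\<close> particles are within reach of
  the factors. The condition \<open>k < n\<close> leaves room for the one row that a horizontal strip may add.
\<close>

lemma trunc_B_slater:
  assumes \<mu>: "antimono \<mu>" "has_rows k \<mu>" "\<mu> 0 \<le> M" and n: "k < n" and L: "L = 2 - int n"
  shows "trunc_B x L (int M) (slater n \<mu>) =
    (\<Sum>\<nu> | interlaces \<mu> \<nu> \<and> \<nu> 0 \<le> M. scal (x ^ (weight \<nu> - weight \<mu>)) (slater n \<nu>))"
proof -
  let ?p = "\<lambda>i. slot i (\<mu> i)" and ?u = "\<lambda>i. case i of 0 \<Rightarrow> M | Suc j \<Rightarrow> \<mu> j"
  have le: "\<mu> i \<le> M" for i using antimonoD[OF \<mu>(1), of 0 i] \<mu>(3) by simp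
  have "trunc_B x L (int M) (b (?p i) v)
      = creation (\<lambda>q. x ^ nat (?p i - q)) {1 - int M..?p i} (trunc_B x L (int M) v)" if "i < n" for i v
  proof -
    have "min (?p i) (1 - int M) = 1 - int M"
      using le[of i] by (simp add: slot_def)
    moreover have "?p i \<le> 2 - L" using that by (simp add: L slot_def)
    ultimately show ?thesis
      using n by (subst trunc_B_b) (auto simp: L creation_def)
  qed
  then have "trunc_B x L (int M) (slater n \<mu>) =
      foldr (\<lambda>i. creation (\<lambda>q. x ^ nat (?p i - q)) {1 - int M..?p i}) [0..<n] (low_vac n)"
    unfolding slater_def
    by (subst foldr_intertwine[where T = "trunc_B x L (int M)"]) (auto simp: L trunc_B_low_vac)
  also have "\<dots> = foldr (\<lambda>i. creation (\<lambda>q. x ^ nat (?p i - q))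
      {(case i of 0 \<Rightarrow> 1 - int M | Suc j \<Rightarrow> ?p j + 1)..?p i}) [0..<n] (low_vac n)"
    using slot_less[OF \<mu>(1)] le[of 0] by (intro foldr_creation_left) (auto simp: slot_def)
  also have "(\<lambda>i. {(case i of 0 \<Rightarrow> 1 - int M | Suc j \<Rightarrow> ?p j + 1)..?p i}) = (\<lambda>i. {slot i (?u i)..slot i (\<mu> i)})"
    by (auto simp: fun_eq_iff slot_def split: nat.splits)
  then have "foldr (\<lambda>i. creation (\<lambda>q. x ^ nat (?p i - q))
      {(case i of 0 \<Rightarrow> 1 - int M | Suc j \<Rightarrow> ?p j + 1)..?p i}) [0..<n] (low_vac n)
    = foldr (\<lambda>i v. \<Sum>m\<in>{\<mu> i..?u i}. scal (x ^ nat (?p i - slot i m)) (b (slot i m) v)) [0..<n] (low_vac n)"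
    by (simp only: creation_slots fun_eq_iff)
  also have "\<dots> = (\<Sum>\<nu> | has_rows n \<nu> \<and> (\<forall>i<n. \<nu> i \<in> {\<mu> i..?u i}).
      scal (\<Prod>i<n. x ^ nat (?p i - slot i (\<nu> i))) (slater n \<nu>))"
    by (rule foldr_sums_slater) simp
  also have "\<dots> = (\<Sum>\<nu> | interlaces \<mu> \<nu> \<and> \<nu> 0 \<le> M. scal (x ^ (weight \<nu> - weight \<mu>)) (slater n \<nu>))"
    unfolding interlaces_above_eq[OF \<mu>(2) n]
  proof (rule sum.cong[OF refl])
    fix \<nu> assume "\<nu> \<in> {\<nu>. interlaces \<mu> \<nu> \<and> \<nu> 0 \<le> M}"
    then have il: "interlaces \<mu> \<nu>" by simp
    then have "has_rows n \<nu>" using rows_mono[OF interlaces_rows(2)[OF _ \<mu>(2)] Suc_leI[OF n]] by blast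
    moreover have "nat (?p i - slot i (\<nu> i)) = \<nu> i - \<mu> i" for i by (simp add: slot_def nat_diff_distrib')
    ultimately show "scal (\<Prod>i<n. x ^ nat (?p i - slot i (\<nu> i))) (slater n \<nu>) = scal (x ^ (weight \<nu> - weight \<mu>)) (slater n \<nu>)"
      using prod_power_interlaces[OF il, of n x] by simp
  qed
  finally show ?thesis .
qed

lemma trunc_C_slater:
  assumes \<mu>: "antimono \<mu>" "has_rows n \<mu>" "\<mu> 0 \<le> M" and L: "L = 2 - int n"
  shows "trunc_C x L (int M) (slater n \<mu>) =
    (\<Sum>\<nu> | interlaces \<nu> \<mu>. scal (x ^ (weight \<mu> - weight \<nu>)) (slater n \<nu>))"
proof (cases "n = 0")
  case True
  have "interlaces \<nu> \<mu> \<longleftrightarrow> \<nu> = \<mu>" for \<nu>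
    using \<mu>(2) True by (auto simp: interlaces_def has_rows_def fun_eq_iff)
  with True show ?thesis using trunc_C_low_vac[of x L "int M" 0] by (simp add: slater_def)
next
  case n: False
  let ?p = "\<lambda>i. slot i (\<mu> i)"
  have le: "\<mu> i \<le> M" for i using antimonoD[OF \<mu>(1), of 0 i] \<mu>(3) by simp
  have pn: "?p n - 1 = int n" using \<mu>(2) by (simp add: slot_def has_rows_def)
  have "trunc_C x L (int M) (b (?p i) v)
      = creation (\<lambda>q. x ^ nat (q - ?p i)) {?p i..?p n - 1} (trunc_C x L (int M) v)" if "i < n" for i v
  proof -
    have "1 - int M \<le> ?p i"
      using le[of i] by (simp add: slot_def)
    moreover have "max (?p i) (2 - L) = ?p n - 1" using that by (simp add: L pn) (simp add: slot_def)
    ultimately show ?thesis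
      using n by (subst trunc_C_b) (auto simp: L creation_def)
  qed
  then have "trunc_C x L (int M) (slater n \<mu>) =
      foldr (\<lambda>i. creation (\<lambda>q. x ^ nat (q - ?p i)) {?p i..?p n - 1}) [0..<n] (low_vac n)"
    unfolding slater_def
    by (subst foldr_intertwine[where T = "trunc_C x L (int M)"]) (auto simp: trunc_C_low_vac)
  also have "\<dots> = foldr (\<lambda>i. creation (\<lambda>q. x ^ nat (q - ?p i)) {?p i..?p (Suc i) - 1}) [0..<n] (low_vac n)"
    using slot_less[OF \<mu>(1)] by (intro foldr_creation_right) auto
  also have "\<dots> = foldr (\<lambda>i v. \<Sum>m\<in>{\<mu> (Suc i)..\<mu> i}. scal (x ^ nat (slot i m - ?p i)) (b (slot i m) v)) [0..<n] (low_vac n)"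
  proof -
    have "?p (Suc i) - 1 = slot i (\<mu> (Suc i))" for i by (simp add: slot_def)
    then show ?thesis by (simp only: creation_slots)
  qed
  also have "\<dots> = (\<Sum>\<nu> | has_rows n \<nu> \<and> (\<forall>i<n. \<nu> i \<in> {\<mu> (Suc i)..\<mu> i}).
      scal (\<Prod>i<n. x ^ nat (slot i (\<nu> i) - ?p i)) (slater n \<nu>))"
    by (rule foldr_sums_slater) simp
  also have "\<dots> = (\<Sum>\<nu> | interlaces \<nu> \<mu>. scal (x ^ (weight \<mu> - weight \<nu>)) (slater n \<nu>))"
    unfolding interlaces_below_eq[OF \<mu>(2)]
  proof (rule sum.cong[OF refl])
    fix \<nu> assume "\<nu> \<in> {\<nu>. interlaces \<nu> \<mu>}"
    moreover have "nat (slot i (\<nu> i) - ?p i) = \<mu> i - \<nu> i" for i by (simp add: slot_def nat_diff_distrib')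
    ultimately show "scal (\<Prod>i<n. x ^ nat (slot i (\<nu> i) - ?p i)) (slater n \<nu>) = scal (x ^ (weight \<mu> - weight \<nu>)) (slater n \<nu>)"
      using prod_power_interlaces[OF _ \<mu>(2), of \<nu> x] by simp
  qed
  finally show ?thesis .
qed

section \<open>The vacuum expectation value\<close>

lemma eventually_trunc_B_slater:
  assumes \<mu>: "\<mu> \<in> box k M" and "k < N"
  shows "\<forall>\<^sub>F L in at_bot. trunc_B x L (int M) (slater N \<mu>) =
    (\<Sum>\<nu> | interlaces \<mu> \<nu> \<and> \<nu> 0 \<le> M. scal (x ^ (weight \<nu> - weight \<mu>)) (slater N \<nu>))"
  unfolding eventually_at_bot_linorder
proof (intro exI allI impI)
  fix L :: int assume L: "L \<le> 2 - int N"
  define n where "n = nat (2 - L)"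
  have n: "N \<le> n" "L = 2 - int n" using L by (auto simp: n_def)
  have \<mu>': "antimono \<mu>" "has_rows k \<mu>" "\<mu> 0 \<le> M" using \<mu> by (auto simp: box_def)
  have rows: "has_rows N \<nu>" if "interlaces \<mu> \<nu>" for \<nu>
    using rows_mono[OF interlaces_rows(2)[OF that \<mu>'(2)]] assms(2) by simp
  have "trunc_B x L (int M) (slater N \<mu>) = trunc_B x L (int M) (slater n \<mu>)"
    using slater_extend[OF rows_mono[OF \<mu>'(2) less_imp_le[OF assms(2)]] n(1)] by simp
  also have "\<dots> = (\<Sum>\<nu> | interlaces \<mu> \<nu> \<and> \<nu> 0 \<le> M. scal (x ^ (weight \<nu> - weight \<mu>)) (slater n \<nu>))"
    using assms(2) n by (intro trunc_B_slater[OF \<mu>']) auto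
  also have "\<dots> = (\<Sum>\<nu> | interlaces \<mu> \<nu> \<and> \<nu> 0 \<le> M. scal (x ^ (weight \<nu> - weight \<mu>)) (slater N \<nu>))"
    by (rule sum.cong) (auto simp: slater_extend[OF rows n(1)])
  finally show "trunc_B x L (int M) (slater N \<mu>) = \<dots>" .
qed

lemma eventually_trunc_C_slater:
  assumes \<mu>: "\<mu> \<in> box N M"
  shows "\<forall>\<^sub>F L in at_bot. trunc_C x L (int M) (slater N \<mu>) =
    (\<Sum>\<nu> | interlaces \<nu> \<mu>. scal (x ^ (weight \<mu> - weight \<nu>)) (slater N \<nu>))"
  unfolding eventually_at_bot_linorder
proof (intro exI allI impI)
  fix L :: int assume L: "L \<le> 2 - int N"
  define n where "n = nat (2 - L)"
  have n: "N \<le> n" "L = 2 - int n" using L by (auto simp: n_def)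
  have \<mu>': "antimono \<mu>" "has_rows N \<mu>" "\<mu> 0 \<le> M" using \<mu> by (auto simp: box_def)
  have "trunc_C x L (int M) (slater N \<mu>) = trunc_C x L (int M) (slater n \<mu>)"
    using slater_extend[OF \<mu>'(2) n(1)] by simp
  also have "\<dots> = (\<Sum>\<nu> | interlaces \<nu> \<mu>. scal (x ^ (weight \<mu> - weight \<nu>)) (slater n \<nu>))"
    using \<mu>' rows_mono n by (intro trunc_C_slater) auto
  also have "\<dots> = (\<Sum>\<nu> | interlaces \<nu> \<mu>. scal (x ^ (weight \<mu> - weight \<nu>)) (slater N \<nu>))"
    by (rule sum.cong) (auto simp: slater_extend[OF interlaces_rows(1)[OF _ \<mu>'(2)] n(1)])
  finally show "trunc_C x L (int M) (slater N \<mu>) = \<dots>" .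
qed

text \<open>
  The infinite products need not be linear on the whole module, since their eventual value may
  fail to exist. Linearity holds for the truncated products and passes to eventual values over
  finite combinations.
\<close>

lemma eventually_linear_sum:
  assumes "\<And>L. linear_op (T L)" "finite A" "\<And>\<mu>. \<mu> \<in> A \<Longrightarrow> \<forall>\<^sub>F L in at_bot. T (L :: int) (v \<mu>) = w \<mu>"
  shows "\<forall>\<^sub>F L in at_bot. T L (\<Sum>\<mu>\<in>A. scal (a \<mu>) (v \<mu>)) = (\<Sum>\<mu>\<in>A. scal (a \<mu>) (w \<mu>))"
proof -
  have "\<forall>\<^sub>F L in at_bot. \<forall>\<mu>\<in>A. T L (v \<mu>) = w \<mu>"
    using assms(2,3) by (simp add: eventually_ball_finite)
  then show ?thesis
    by eventually_elim (simp add: linear_op_sum_map[OF assms(1)])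
qed

lemma fermion_B_sum:
  assumes "k < N"
  shows "fermion_B scal b c M x (\<Sum>\<mu>\<in>box k M. scal (a \<mu>) (slater N \<mu>)) =
    (\<Sum>\<nu>\<in>box (Suc k) M. scal (\<Sum>\<mu> | \<mu> \<in> box k M \<and> interlaces \<mu> \<nu>. a \<mu> * x ^ (weight \<nu> - weight \<mu>)) (slater N \<nu>))"
proof -
  have eq: "{\<nu>. interlaces \<mu> \<nu> \<and> \<nu> 0 \<le> M} = {\<nu> \<in> box (Suc k) M. interlaces \<mu> \<nu>}" if "\<mu> \<in> box k M" for \<mu>
    using that interlaces_antimono(2) interlaces_rows(2) by (auto simp: box_def)
  have "fermion_B scal b c M x (\<Sum>\<mu>\<in>box k M. scal (a \<mu>) (slater N \<mu>)) =
    (\<Sum>\<mu>\<in>box k M. scal (a \<mu>) (\<Sum>\<nu> | interlaces \<mu> \<nu> \<and> \<nu> 0 \<le> M. scal (x ^ (weight \<nu> - weight \<mu>)) (slater N \<nu>)))"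
    unfolding fermion_B_eq
    by (intro eventual_value_eqI eventually_linear_sum linear_trunc finite_box eventually_trunc_B_slater[OF _ assms])
  also have "\<dots> = (\<Sum>\<mu>\<in>box k M. \<Sum>\<nu> | \<nu> \<in> box (Suc k) M \<and> interlaces \<mu> \<nu>. scal (a \<mu> * x ^ (weight \<nu> - weight \<mu>)) (slater N \<nu>))"
    by (rule sum.cong) (simp_all add: eq scale_sum_right)
  also have "\<dots> = (\<Sum>\<nu>\<in>box (Suc k) M. \<Sum>\<mu> | \<mu> \<in> box k M \<and> interlaces \<mu> \<nu>. scal (a \<mu> * x ^ (weight \<nu> - weight \<mu>)) (slater N \<nu>))"
    by (rule sum.swap_restrict) (rule finite_box)+
  finally show ?thesis by (simp only: scale_sum_left)
qed

lemma fermion_C_sum: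
  "fermion_C scal b c M x (\<Sum>\<mu>\<in>box N M. scal (a \<mu>) (slater N \<mu>)) =
    (\<Sum>\<nu>\<in>box N M. scal (\<Sum>\<mu> | \<mu> \<in> box N M \<and> interlaces \<nu> \<mu>. a \<mu> * x ^ (weight \<mu> - weight \<nu>)) (slater N \<nu>))"
proof -
  have "fermion_C scal b c M x (\<Sum>\<mu>\<in>box N M. scal (a \<mu>) (slater N \<mu>)) =
    (\<Sum>\<mu>\<in>box N M. scal (a \<mu>) (\<Sum>\<nu> | interlaces \<nu> \<mu>. scal (x ^ (weight \<mu> - weight \<nu>)) (slater N \<nu>)))"
    unfolding fermion_C_eq
    by (intro eventual_value_eqI eventually_linear_sum linear_trunc finite_box eventually_trunc_C_slater)
  also have "\<dots> = (\<Sum>\<mu>\<in>box N M. \<Sum>\<nu> | \<nu> \<in> box N M \<and> interlaces \<nu> \<mu>. scal (a \<mu> * x ^ (weight \<mu> - weight \<nu>)) (slater N \<nu>))"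
    by (rule sum.cong) (simp_all add: interlaces_below_box[symmetric] scale_sum_right)
  also have "\<dots> = (\<Sum>\<nu>\<in>box N M. \<Sum>\<mu> | \<mu> \<in> box N M \<and> interlaces \<nu> \<mu>. scal (a \<mu> * x ^ (weight \<mu> - weight \<nu>)) (slater N \<nu>))"
    by (rule sum.swap_restrict) (rule finite_box)+
  finally show ?thesis by (simp only: scale_sum_left)
qed

text \<open>
  Each application of \<open>B\<close> adds at most one row, so after \<open>length js\<close> of them only partitions with that many rows
  occur, and the coefficients obey the branching rule.
\<close>

lemma foldr_fermion_B_vac:
  "length js \<le> N \<Longrightarrow> foldr (\<lambda>j. fermion_B scal b c M (y j)) js vac =
    (\<Sum>\<mu>\<in>box (length js) M. scal (branch_schur (map y js) \<mu>) (slater N \<mu>))"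
proof (induction js)
  case Nil
  show ?case by (simp add: box_0 slater_empty)
next
  case (Cons j js)
  have "(\<Sum>\<mu> | \<mu> \<in> box (length js) M \<and> interlaces \<mu> \<nu>. branch_schur (map y js) \<mu> * y j ^ (weight \<nu> - weight \<mu>))
      = branch_schur (map y (j # js)) \<nu>" if \<nu>: "\<nu> \<in> box (Suc (length js)) M" for \<nu>
  proof -
    \<comment> \<open>A \<open>\<mu>\<close> below \<open>\<nu>\<close> but outside the smaller box has too many rows for the variables.\<close>
    have "branch_schur (map y js) \<mu> = 0" if "interlaces \<mu> \<nu>" "\<mu> \<notin> box (length js) M" for \<mu>
    proof (rule ccontr)
      assume "branch_schur (map y js) \<mu> \<noteq> 0"
      then have "has_rows (length js) \<mu>"
        using branch_schur_length[of "map y js" \<mu>] antimono_rows_iff interlaces_antimono(1)[OF that(1)] by simp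
      moreover have "\<mu> 0 \<le> M" using \<nu> that(1) by (auto simp: box_def interlaces_def intro: order_trans)
      ultimately show False using that interlaces_antimono(1) by (auto simp: box_def)
    qed
    note zero = this
    have "finite {\<mu>. interlaces \<mu> \<nu>}"
      using \<nu> by (auto simp: box_def intro: finite_interlaces_below)
    then have "(\<Sum>\<mu> | \<mu> \<in> box (length js) M \<and> interlaces \<mu> \<nu>. branch_schur (map y js) \<mu> * y j ^ (weight \<nu> - weight \<mu>))
        = (\<Sum>\<mu> | interlaces \<mu> \<nu>. branch_schur (map y js) \<mu> * y j ^ (weight \<nu> - weight \<mu>))"
    proof (rule sum.mono_neutral_left)
      show "\<forall>\<mu>\<in>{\<mu>. interlaces \<mu> \<nu>} - {\<mu>. \<mu> \<in> box (length js) M \<and> interlaces \<mu> \<nu>}.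
          branch_schur (map y js) \<mu> * y j ^ (weight \<nu> - weight \<mu>) = 0"
      proof
        fix \<mu> assume "\<mu> \<in> {\<mu>. interlaces \<mu> \<nu>} - {\<mu>. \<mu> \<in> box (length js) M \<and> interlaces \<mu> \<nu>}"
        then have "interlaces \<mu> \<nu>" "\<mu> \<notin> box (length js) M" by auto
        then show "branch_schur (map y js) \<mu> * y j ^ (weight \<nu> - weight \<mu>) = 0" using zero[of \<mu>] by simp
      qed
    qed auto
    then show ?thesis by (simp add: mult.commute)
  qed
  moreover have "foldr (\<lambda>j. fermion_B scal b c M (y j)) js vac =
    (\<Sum>\<mu>\<in>box (length js) M. scal (branch_schur (map y js) \<mu>) (slater N \<mu>))"
    using Cons by simp
  ultimately show ?case
    using Cons.prems by (simp add: fermion_B_sum del: branch_schur.simps)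
qed

text \<open>
  In the state of a nonempty partition the leftmost particle has left the sea, and the dual
  vacuum annihilates its creation operator.
\<close>

lemma dvac_slater:
  assumes "antimono \<mu>" "has_rows N \<mu>"
  shows "dvac (slater N \<mu>) = (if \<mu> = (\<lambda>_. 0) then 1 else 0)"
proof (cases "\<mu> = (\<lambda>_. 0)")
  case True
  then show ?thesis by (simp add: slater_empty dvac_vac)
next
  case False
  then have "\<mu> 0 > 0" using antimono_rows_iff[OF assms(1), of 0] by (auto simp: has_rows_def fun_eq_iff)
  moreover have "N > 0" using assms(2) \<open>\<mu> 0 > 0\<close> by (cases N) (auto simp: has_rows_def)
  ultimately show ?thesis
    using False dvac_b[of "- int (\<mu> 0)"] by (simp add: slater_def upt_conv_Cons slot_def)
qed

lemma dvac_fold_fermion_C: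
  "dvac (fold (\<lambda>i. fermion_C scal b c M (x i)) is (\<Sum>\<mu>\<in>box N M. scal (a \<mu>) (slater N \<mu>))) =
    (\<Sum>\<mu>\<in>box N M. a \<mu> * branch_schur (map x is) \<mu>)"
proof (induction "is" arbitrary: a)
  case Nil
  show ?case
    by (simp add: module_hom.sum[OF linear_dvac] module_hom.scale[OF linear_dvac])
      (rule sum.cong, auto simp: box_def dvac_slater)
next
  case (Cons i "is")
  have "dvac (fold (\<lambda>i. fermion_C scal b c M (x i)) (i # is) (\<Sum>\<mu>\<in>box N M. scal (a \<mu>) (slater N \<mu>)))
      = (\<Sum>\<nu>\<in>box N M. \<Sum>\<mu> | \<mu> \<in> box N M \<and> interlaces \<nu> \<mu>.
          a \<mu> * x i ^ (weight \<mu> - weight \<nu>) * branch_schur (map x is) \<nu>)"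
    by (simp add: fermion_C_sum Cons.IH sum_distrib_right)
  also have "\<dots> = (\<Sum>\<mu>\<in>box N M. \<Sum>\<nu> | \<nu> \<in> box N M \<and> interlaces \<nu> \<mu>.
          a \<mu> * x i ^ (weight \<mu> - weight \<nu>) * branch_schur (map x is) \<nu>)"
    by (rule sum.swap_restrict) (rule finite_box)+
  also have "\<dots> = (\<Sum>\<mu>\<in>box N M. a \<mu> * branch_schur (map x (i # is)) \<mu>)"
    by (rule sum.cong) (simp_all add: interlaces_below_box sum_distrib_left mult.assoc)
  finally show ?case .
qed

text \<open>
  The operators \<open>B\<close> build each partition from the empty one along chains of horizontal strips, and the
  operators \<open>C\<close> reduce it to the empty one along such chains, with the variables in the same order.
\<close>

theorem CB_vev_eq_sum_branch_schur:
  "CB_vev scal b c vac dvac M N x y =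
    (\<Sum>\<mu>\<in>box N M. branch_schur (map x [1..<N + 1]) \<mu> * branch_schur (map y [1..<N + 1]) \<mu>)"
proof -
  have "foldr (\<lambda>j. fermion_B scal b c M (y j)) [1..<N + 1] vac =
    (\<Sum>\<mu>\<in>box N M. scal (branch_schur (map y [1..<N + 1]) \<mu>) (slater N \<mu>))"
  proof -
    have len: "length [1..<N + 1] = N" by simp
    show ?thesis
      using foldr_fermion_B_vac[OF eq_refl[OF len], of M y] by (simp only: len)
  qed
  then show ?thesis
    unfolding CB_vev_def by (simp only: dvac_fold_fermion_C mult.commute)
qed

end

section \<open>From the graded identity to power series in two sets of variables\<close>

text \<open>
  The degree of a monomial in the variables \<open>Y j\<close>; it plays the role of the grading by the weight.
\<close>

definition ydeg :: "(xy_var \<Rightarrow>\<^sub>0 nat) \<Rightarrow> nat" where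
  "ydeg m = Sum_any (\<lambda>j. Poly_Mapping.lookup m (Y j))"

lemma ydeg_add: "ydeg (p + q) = ydeg p + ydeg q"
proof -
  have "finite {j. Poly_Mapping.lookup m (Y j) \<noteq> 0}" for m :: "xy_var \<Rightarrow>\<^sub>0 nat"
    using finite_vimageI[of "Poly_Mapping.keys m" Y] by (simp add: vimage_def inj_on_def in_keys_iff)
  then show ?thesis by (simp add: ydeg_def lookup_add Sum_any.distrib)
qed

lemma ydeg_0: "ydeg 0 = 0"
  by (simp add: ydeg_def)

definition yhomog :: "nat \<Rightarrow> (xy_var, 'k :: comm_ring_1) mps \<Rightarrow> bool" where
  "yhomog d f \<longleftrightarrow> (\<forall>m. coeff_mps f m \<noteq> 0 \<longrightarrow> ydeg m = d)"

lemma coeff_zero: "coeff_mps 0 m = 0" by (simp add: zero_mps_def)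
lemma coeff_one: "coeff_mps 1 m = (if m = 0 then 1 else 0)" by (simp add: one_mps_def)
lemma coeff_add: "coeff_mps (f + g) m = coeff_mps f m + coeff_mps g m" by (simp add: plus_mps_def)
lemma coeff_minus: "coeff_mps (- f) m = - coeff_mps f m" by (simp add: uminus_mps_def)
lemma coeff_diff: "coeff_mps (f - g) m = coeff_mps f m - coeff_mps g m" by (simp add: minus_mps_def)
lemma coeff_mult: "coeff_mps (f * g) m = (\<Sum>(p, q) | p + q = m. coeff_mps f p * coeff_mps g q)"
  by (simp add: times_mps_def)

lemma coeff_sum: "coeff_mps (\<Sum>i\<in>A. f i) m = (\<Sum>i\<in>A. coeff_mps (f i) m)"
  by (induction A rule: infinite_finite_induct) (simp_all add: coeff_zero coeff_add)

lemma yhomog_zero: "yhomog d 0" by (simp add: yhomog_def coeff_zero)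
lemma yhomog_one: "yhomog 0 1" by (simp add: yhomog_def coeff_one ydeg_0)
lemma yhomog_minus: "yhomog d f \<Longrightarrow> yhomog d (- f)" by (simp add: yhomog_def coeff_minus)

lemma yhomog_sum: "(\<And>i. i \<in> A \<Longrightarrow> yhomog d (f i)) \<Longrightarrow> yhomog d (\<Sum>i\<in>A. f i)"
  unfolding yhomog_def coeff_sum by (meson sum.not_neutral_contains_not_neutral)

lemma yhomog_mult:
  assumes "yhomog d f" "yhomog e g"
  shows "yhomog (d + e) (f * g)"
  unfolding yhomog_def
proof (intro allI impI)
  fix m assume "coeff_mps (f * g) m \<noteq> 0"
  then obtain z where z: "z \<in> {(p, q). p + q = m}" "(case z of (p, q) \<Rightarrow> coeff_mps f p * coeff_mps g q) \<noteq> 0"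
    unfolding coeff_mult by (rule sum.not_neutral_contains_not_neutral)
  obtain p q where "z = (p, q)" by force
  with z have "p + q = m" "coeff_mps f p \<noteq> 0" "coeff_mps g q \<noteq> 0" by auto
  with assms show "ydeg m = d + e" unfolding yhomog_def using ydeg_add by blast
qed

lemma yhomog_power: "yhomog d f \<Longrightarrow> yhomog (d * k) (f ^ k)"
  by (induction k) (simp_all add: yhomog_one yhomog_mult)

lemma yhomog_var_X: "yhomog 0 (var_mps (X i))" and yhomog_var_Y: "yhomog 1 (var_mps (Y i))"
  by (simp_all add: yhomog_def var_mps_def ydeg_def lookup_single when_def)

lemma yhomog_branch_schur:
  assumes "\<And>x. x \<in> set xs \<Longrightarrow> yhomog d x"
  shows "has_rows n \<mu> \<Longrightarrow> yhomog (d * weight \<mu>) (branch_schur xs \<mu>)"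
  using assms
proof (induction xs arbitrary: \<mu>)
  case Nil
  have "weight (\<lambda>_. 0) = 0" by (simp add: weight_eq[of 0] has_rows_def)
  then show ?case by (simp add: yhomog_zero yhomog_one)
next
  case (Cons x xs)
  have "yhomog (d * weight \<mu>) (x ^ (weight \<mu> - weight \<nu>) * branch_schur xs \<nu>)"
    if "interlaces \<nu> \<mu>" for \<nu>
  proof -
    have "d * weight \<mu> = d * (weight \<mu> - weight \<nu>) + d * weight \<nu>"
      using interlaces_weight[OF that Cons.prems(1)] by (simp add: diff_mult_distrib2)
    then show ?thesis
      using Cons that interlaces_rows(1)[OF that Cons.prems(1)]
      by (auto intro!: yhomog_mult yhomog_power)
  qed
  then show ?case by (auto intro: yhomog_sum)
qed

text \<open>
  The substitution \<open>t = 1\<close> in a power series in \<open>t\<close> whose coefficient of \<open>t\<^sup>d\<close> is homogeneous of degree \<open>d\<close>: a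
  monomial can only come from the coefficient whose index is its own degree.
\<close>

definition gather :: "(xy_var, 'k :: comm_ring_1) mps fps \<Rightarrow> (xy_var, 'k) mps" where
  "gather F = Abs_mps (\<lambda>m. coeff_mps (fps_nth F (ydeg m)) m)"

definition ygraded :: "(xy_var, 'k :: comm_ring_1) mps fps \<Rightarrow> bool" where
  "ygraded F \<longleftrightarrow> (\<forall>d. yhomog d (fps_nth F d))"

lemma ygraded_mult: "ygraded F \<Longrightarrow> ygraded G \<Longrightarrow> ygraded (F * G)"
  unfolding ygraded_def fps_mult_nth
proof (intro allI yhomog_sum)
  fix d i :: nat assume *: "\<forall>d. yhomog d (fps_nth F d)" "\<forall>d. yhomog d (fps_nth G d)" "i \<in> {0..d}"
  then show "yhomog d (fps_nth F i * fps_nth G (d - i))"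
    using yhomog_mult[of i "fps_nth F i" "d - i" "fps_nth G (d - i)"] by simp
qed

text \<open>
  On graded series the substitution is multiplicative: in the convolution of coefficients only the
  index equal to the degree of the first monomial survives.
\<close>

lemma gather_mult:
  assumes "ygraded F" "ygraded G"
  shows "gather (F * G) = gather F * gather G"
proof (rule mps_eqI)
  fix m
  let ?f = "\<lambda>i. coeff_mps (fps_nth F i)" and ?g = "\<lambda>i. coeff_mps (fps_nth G i)"
  have zero: "?f i p = 0" if "i \<noteq> ydeg p" for i p
    using assms(1) that by (auto simp: ygraded_def yhomog_def)
  have "(\<Sum>i\<in>{0..ydeg m}. ?f i p * ?g (ydeg m - i) q) = ?f (ydeg p) p * ?g (ydeg q) q" if "p + q = m" for p q
  proof -
    have "(\<Sum>i\<in>{0..ydeg m}. ?f i p * ?g (ydeg m - i) q) = (\<Sum>i\<in>{ydeg p}. ?f i p * ?g (ydeg m - i) q)"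
      by (intro sum.mono_neutral_right) (auto simp: that[symmetric] ydeg_add zero)
    then show ?thesis by (simp add: that[symmetric] ydeg_add)
  qed
  then have "(\<Sum>(p, q) | p + q = m. \<Sum>i\<in>{0..ydeg m}. ?f i p * ?g (ydeg m - i) q)
      = (\<Sum>(p, q) | p + q = m. ?f (ydeg p) p * ?g (ydeg q) q)"
    by (intro sum.cong) auto
  then show "coeff_mps (gather (F * G)) m = coeff_mps (gather F * gather G) m"
    by (simp add: gather_def fps_mult_nth coeff_sum coeff_mult case_prod_unfold sum.swap[of _ _ "{0..ydeg m}"])
qed

lemma ygraded_one: "ygraded 1" and gather_one: "gather 1 = 1"
  by (auto simp: ygraded_def yhomog_one yhomog_zero gather_def coeff_one ydeg_0 coeff_zero intro!: mps_eqI)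

lemma ygraded_linear:
  assumes "yhomog 1 t"
  shows "ygraded (1 - fps_const t * fps_X)"
  using assms by (auto simp: ygraded_def yhomog_one yhomog_zero yhomog_minus fps_X_def)

lemma gather_linear:
  assumes "yhomog 1 t"
  shows "gather (1 - fps_const t * fps_X) = 1 - t"
proof (rule mps_eqI)
  fix m
  have "coeff_mps t m = 0" if "ydeg m \<noteq> 1" using assms that by (auto simp: yhomog_def)
  moreover have "m \<noteq> 0" if "ydeg m \<noteq> 0" using that by (auto simp: ydeg_0)
  ultimately show "coeff_mps (gather (1 - fps_const t * fps_X)) m = coeff_mps (1 - t) m"
    by (auto simp: gather_def fps_X_def coeff_diff coeff_one coeff_zero coeff_minus)
qed

lemma gather_prod_list:
  assumes "\<And>i. i \<in> set is \<Longrightarrow> ygraded (F i)"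
  shows "ygraded (\<Prod>i\<leftarrow>is. F i) \<and> gather (\<Prod>i\<leftarrow>is. F i) = (\<Prod>i\<leftarrow>is. gather (F i))"
  using assms by (induction "is") (simp_all add: ygraded_one gather_one ygraded_mult gather_mult)

lemma yhomog_branch_schur_product:
  assumes "\<And>x. x \<in> set xs \<Longrightarrow> yhomog 0 x" "\<And>y. y \<in> set ys \<Longrightarrow> yhomog 1 y" "has_rows n \<mu>"
  shows "yhomog (weight \<mu>) (branch_schur xs \<mu> * branch_schur ys \<mu>)"
  using yhomog_mult[OF yhomog_branch_schur[OF assms(1,3)] yhomog_branch_schur[OF assms(2,3)]] by simp

text \<open>
  Only the finitely many partitions of weight \<open>ydeg m\<close> contribute to the monomial \<open>m\<close>, so every finite
  partial sum that contains them already has the right coefficient.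
\<close>

lemma sum_eq_coeff_gather_cauchy:
  assumes xs: "\<And>x. x \<in> set xs \<Longrightarrow> yhomog 0 x" and ys: "\<And>y. y \<in> set ys \<Longrightarrow> yhomog 1 y"
    and A: "finite A" "partitions_of N (ydeg m) \<subseteq> A" "\<And>\<mu>. \<mu> \<in> A \<Longrightarrow> antimono \<mu> \<and> has_rows N \<mu>"
  shows "coeff_mps (\<Sum>\<mu>\<in>A. branch_schur xs \<mu> * branch_schur ys \<mu>) m
    = coeff_mps (gather (Abs_fps (cauchy_part N xs ys))) m"
proof -
  have "coeff_mps (branch_schur xs \<mu> * branch_schur ys \<mu>) m = 0" if "\<mu> \<in> A - partitions_of N (ydeg m)" for \<mu>
  proof -
    have \<mu>: "antimono \<mu>" "has_rows N \<mu>" using A(3) that by auto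
    have "yhomog (weight \<mu>) (branch_schur xs \<mu> * branch_schur ys \<mu>)"
      using xs ys \<mu>(2) by (rule yhomog_branch_schur_product)
    moreover have "ydeg m \<noteq> weight \<mu>" using that \<mu> by (auto simp: partitions_of_def)
    ultimately show ?thesis by (auto simp: yhomog_def)
  qed
  then show ?thesis
    unfolding gather_def coeff_Abs_mps fps_nth_Abs_fps cauchy_part_def coeff_sum
    by (intro sum.mono_neutral_right[OF A(1,2)]) auto
qed

lemma gather_cauchy_part:
  assumes xs: "\<And>x. x \<in> set xs \<Longrightarrow> yhomog 0 x" and ys: "\<And>y. y \<in> set ys \<Longrightarrow> yhomog 1 y"
    and "length xs \<le> N"
  shows "gather (Abs_fps (cauchy_part N xs ys)) * (\<Prod>y\<leftarrow>ys. \<Prod>x\<leftarrow>xs. 1 - x * y) = 1"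
proof -
  have xy: "yhomog 1 (x * y)" if "x \<in> set xs" "y \<in> set ys" for x y
    using yhomog_mult[OF xs[OF that(1)] ys[OF that(2)]] by simp
  have in1: "ygraded (\<Prod>x\<leftarrow>xs. 1 - fps_const (x * y) * fps_X) \<and>
      gather (\<Prod>x\<leftarrow>xs. 1 - fps_const (x * y) * fps_X) = (\<Prod>x\<leftarrow>xs. 1 - x * y)" if "y \<in> set ys" for y
  proof -
    have "(\<Prod>x\<leftarrow>xs. gather (1 - fps_const (x * y) * fps_X)) = (\<Prod>x\<leftarrow>xs. 1 - x * y)"
      by (intro arg_cong[of _ _ prod_list] map_cong refl gather_linear xy that)
    then show ?thesis
      using gather_prod_list[of xs "\<lambda>x. 1 - fps_const (x * y) * fps_X"] ygraded_linear[OF xy[OF _ that]] by simp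
  qed
  let ?Q = "\<Prod>y\<leftarrow>ys. \<Prod>x\<leftarrow>xs. 1 - fps_const (x * y) * fps_X"
  have "(\<Prod>y\<leftarrow>ys. gather (\<Prod>x\<leftarrow>xs. 1 - fps_const (x * y) * fps_X)) = (\<Prod>y\<leftarrow>ys. \<Prod>x\<leftarrow>xs. 1 - x * y)"
    by (intro arg_cong[of _ _ prod_list] map_cong) (simp_all add: in1)
  then have Q: "ygraded ?Q" "gather ?Q = (\<Prod>y\<leftarrow>ys. \<Prod>x\<leftarrow>xs. 1 - x * y)"
    using gather_prod_list[of ys "\<lambda>y. \<Prod>x\<leftarrow>xs. 1 - fps_const (x * y) * fps_X"] in1 by auto
  have "ygraded (Abs_fps (cauchy_part N xs ys))"
    using yhomog_branch_schur_product[OF xs ys]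
    by (auto simp: ygraded_def cauchy_part_def partitions_of_def intro!: yhomog_sum)
  then have "gather (Abs_fps (cauchy_part N xs ys)) * gather ?Q = gather (Abs_fps (cauchy_part N xs ys) * ?Q)"
    using Q(1) by (simp only: gather_mult)
  also have "\<dots> = 1" by (simp only: fps_cauchy_part[OF assms(3)] gather_one)
  finally show ?thesis by (simp only: Q(2))
qed

text \<open>
  Each factor divides the invertible product, hence is a unit, and division by it is the
  genuine one.
\<close>

lemma prod_inverse_mps:
  fixes f :: "'i \<Rightarrow> 'j \<Rightarrow> ('v, 'k :: comm_ring_1) mps"
  assumes "finite I" "finite J" and P: "P * (\<Prod>i\<in>I. \<Prod>j\<in>J. f i j) = 1"
  shows "(\<Prod>i\<in>I. \<Prod>j\<in>J. 1 / f i j) = P"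
proof -
  let ?Q = "\<Prod>i\<in>I. \<Prod>j\<in>J. f i j" and ?R = "\<Prod>i\<in>I. \<Prod>j\<in>J. 1 / f i j"
  have unit: "f i j * (1 / f i j) = 1" if "i \<in> I" "j \<in> J" for i j
  proof -
    have "f i j dvd (\<Prod>j\<in>J. f i j)" using assms(2) that(2) by (rule dvd_prodI)
    also have "\<dots> dvd ?Q" using assms(1) that(1) by (rule dvd_prodI)
    also have "\<dots> dvd 1" using P by (metis dvd_triv_right)
    finally obtain g where g: "f i j * g = 1" by (metis dvdE)
    then show ?thesis by (simp add: divide_mps_def mps_inverse_unique[OF g])
  qed
  have "?Q * ?R = (\<Prod>i\<in>I. \<Prod>j\<in>J. f i j * (1 / f i j))"
    by (simp add: prod.distrib)
  also have "\<dots> = 1" by (simp add: unit)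
  finally have "?Q * ?R = 1" .
  then have "P = (P * ?Q) * ?R" by (simp add: mult.assoc)
  then show ?thesis by (simp add: P)
qed

section \<open>The vacuum expectation value and the Cauchy kernel\<close>

theorem theorem2p2:
  fixes scal :: "(xy_var, 'k :: field_char_0) mps \<Rightarrow> 'e :: ab_group_add \<Rightarrow> 'e"
    and b c :: "int \<Rightarrow> 'e \<Rightarrow> 'e" and vac :: 'e and dvac :: "'e \<Rightarrow> (xy_var, 'k) mps"
    and M N :: nat
    and x y :: "nat \<Rightarrow> (xy_var, 'k) mps"
  assumes "x = (\<lambda>i. var_mps (X i))" and "y = (\<lambda>j. var_mps (Y j))"
    and "fermions scal b c vac dvac"
    and "M \<ge> 1" and "N \<ge> 1"
  shows "CB_vev scal b c vac dvac M N x y =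
      (\<Sum>\<mu> | is_partition \<mu> \<and> length \<mu> \<le> N \<and> (\<forall>p\<in>set \<mu>. p \<le> M). schur N x \<mu> * schur N y \<mu>)
    \<and> (\<lambda>K. CB_vev scal b c vac dvac K N x y) \<longlonglongrightarrow> (\<Prod>i=1..N. \<Prod>j=1..N. 1 / (1 - x i * y j))
    \<and> ((\<lambda>\<mu>. schur N x \<mu> * schur N y \<mu>) has_sum (\<Prod>i=1..N. \<Prod>j=1..N. 1 / (1 - x i * y j)))
        {\<mu>. is_partition \<mu> \<and> length \<mu> \<le> N}"
proof (intro conjI)
  interpret mps_fermions scal b c vac dvac
    using assms(3) by (simp add: mps_fermions_def)
  define xs where "xs = map x [1..<N + 1]"
  define ys where "ys = map y [1..<N + 1]"
  define T where "T = (\<lambda>\<mu>. branch_schur xs \<mu> * branch_schur ys \<mu>)"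
  define P where "P = gather (Abs_fps (cauchy_part N xs ys))"
  have xs: "yhomog 0 z" if "z \<in> set xs" for z
    using that by (auto simp: xs_def assms(1) yhomog_var_X)
  have ys: "yhomog 1 z" if "z \<in> set ys" for z
    using that yhomog_var_Y by (auto simp: ys_def assms(2))
  have schur: "schur N x \<mu> * schur N y \<mu> = T (pad \<mu>)" if "is_partition \<mu>" for \<mu>
    using that by (simp only: schur_eq_branch_schur T_def xs_def ys_def)
  have vev: "CB_vev scal b c vac dvac K N x y = (\<Sum>\<mu>\<in>box N K. T \<mu>)" for K
    by (simp only: CB_vev_eq_sum_branch_schur T_def xs_def ys_def)
  have coeff: "coeff_mps (\<Sum>\<mu>\<in>A. T \<mu>) m = coeff_mps P m"
    if "finite A" "partitions_of N (ydeg m) \<subseteq> A" "A \<subseteq> {\<mu>. antimono \<mu> \<and> has_rows N \<mu>}" for A m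
    unfolding T_def P_def using that by (intro sum_eq_coeff_gather_cauchy xs ys) auto
  have prod_list: "(\<Prod>z\<leftarrow>map f [1..<N + 1]. g z) = (\<Prod>i=1..N. g (f i))"
    for f :: "nat \<Rightarrow> (xy_var, 'k) mps" and g :: "(xy_var, 'k) mps \<Rightarrow> (xy_var, 'k) mps"
  proof -
    have "set [1..<N + 1] = {1..N}" by auto
    then show ?thesis
      using prod.distinct_set_conv_list[of "[1..<N + 1]" "\<lambda>i. g (f i)"] by (simp add: o_def del: upt_Suc)
  qed
  have "P * (\<Prod>j=1..N. \<Prod>i=1..N. 1 - x i * y j) = 1"
  proof -
    have "length xs \<le> N" by (simp add: xs_def)
    from gather_cauchy_part[of xs ys N, OF xs ys this] show ?thesis
      by (simp only: P_def xs_def ys_def prod_list)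
  qed
  moreover have "(\<Prod>j=1..N. \<Prod>i=1..N. 1 - x i * y j) = (\<Prod>i=1..N. \<Prod>j=1..N. 1 - x i * y j)"
    by (rule prod.swap)
  ultimately have "P * (\<Prod>i=1..N. \<Prod>j=1..N. 1 - x i * y j) = 1"
    by (simp only:)
  then have P: "(\<Prod>i=1..N. \<Prod>j=1..N. 1 / (1 - x i * y j)) = P"
    by (intro prod_inverse_mps) auto

  show "CB_vev scal b c vac dvac M N x y =
      (\<Sum>\<mu> | is_partition \<mu> \<and> length \<mu> \<le> N \<and> (\<forall>p\<in>set \<mu>. p \<le> M). schur N x \<mu> * schur N y \<mu>)"
    unfolding vev sum.reindex_bij_betw[OF bij_betw_pad_box, symmetric]
    by (rule sum.cong) (auto simp: schur)

  show "(\<lambda>K. CB_vev scal b c vac dvac K N x y) \<longlonglongrightarrow> (\<Prod>i=1..N. \<Prod>j=1..N. 1 / (1 - x i * y j))"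
    unfolding P tendsto_mps_iff
  proof
    fix m
    show "\<forall>\<^sub>F K in sequentially. coeff_mps (CB_vev scal b c vac dvac K N x y) m = coeff_mps P m"
      using eventually_ge_at_top[of "ydeg m"]
    proof eventually_elim
      case (elim K)
      have "partitions_of N (ydeg m) \<subseteq> box N K"
      proof
        fix \<mu> assume "\<mu> \<in> partitions_of N (ydeg m)"
        then show "\<mu> \<in> box N K"
          using elim weight_ge_part[of N \<mu> 0] by (simp add: partitions_of_def box_def)
      qed
      then show ?case
        unfolding vev by (intro coeff finite_box) (auto simp: box_def)
    qed
  qed

  show "((\<lambda>\<mu>. schur N x \<mu> * schur N y \<mu>) has_sum (\<Prod>i=1..N. \<Prod>j=1..N. 1 / (1 - x i * y j)))
        {\<mu>. is_partition \<mu> \<and> length \<mu> \<le> N}"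
    unfolding P has_sum_def tendsto_mps_iff
  proof
    fix m
    let ?L = "{\<mu>. is_partition \<mu> \<and> length \<mu> \<le> N}"
    define S where "S = {\<mu> \<in> ?L. pad \<mu> \<in> partitions_of N (ydeg m)}"
    have inj: "inj_on pad ?L" and img: "pad ` ?L = {\<mu>. antimono \<mu> \<and> has_rows N \<mu>}"
      using bij_betw_pad[of N] by (auto simp: bij_betw_def)
    have S: "finite S"
      by (rule inj_on_finite[OF inj_on_subset[OF inj] _ finite_partitions_of[of N "ydeg m"]]) (auto simp: S_def)
    have "coeff_mps (\<Sum>\<mu>\<in>A. schur N x \<mu> * schur N y \<mu>) m = coeff_mps P m"
      if A: "finite A" "S \<subseteq> A" "A \<subseteq> ?L" for A
    proof -
      have "(\<Sum>\<mu>\<in>A. schur N x \<mu> * schur N y \<mu>) = (\<Sum>\<mu>\<in>A. T (pad \<mu>))"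
        using A(3) by (intro sum.cong) (auto simp: schur)
      also have "\<dots> = (\<Sum>\<mu>\<in>pad ` A. T \<mu>)"
        by (simp add: sum.reindex[OF inj_on_subset[OF inj A(3)]])
      finally have "(\<Sum>\<mu>\<in>A. schur N x \<mu> * schur N y \<mu>) = (\<Sum>\<mu>\<in>pad ` A. T \<mu>)" .
      moreover have "partitions_of N (ydeg m) \<subseteq> pad ` A"
      proof
        fix \<mu> assume \<mu>: "\<mu> \<in> partitions_of N (ydeg m)"
        then have "\<mu> \<in> pad ` ?L" unfolding img by (simp add: partitions_of_def)
        with \<mu> A(2) show "\<mu> \<in> pad ` A" by (auto simp: S_def)
      qed
      moreover have "pad ` A \<subseteq> {\<mu>. antimono \<mu> \<and> has_rows N \<mu>}"
        unfolding img[symmetric] using A(3) by blast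
      ultimately show ?thesis using coeff A(1) by simp
    qed
    then show "\<forall>\<^sub>F A in finite_subsets_at_top ?L.
        coeff_mps (\<Sum>\<mu>\<in>A. schur N x \<mu> * schur N y \<mu>) m = coeff_mps P m"
      unfolding eventually_finite_subsets_at_top using S by (intro exI[of _ S]) (auto simp: S_def)
  qed
qed

end
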